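(* Let $(\mathcal{R},\leq,r)$ be a topological Ramsey space and $\mathcal{H}\subseteq\mathcal{R}$ a selective coideal. Then the family of $\mathcal{H}$-Ramsey subsets of $\mathcal{R}$ is closed under the Souslin operation: if $\mathcal{X}_s\subseteq\mathcal{R}$ is $\mathcal{H}$-Ramsey for every finite sequence $s\in\mathbb{N}^{<\omega}$, then $\bigcup_{x\in\mathbb{N}^{\mathbb{N}}}\bigcap_{n\in\mathbb{N}}\mathcal{X}_{x\upharpoonright n}$ is $\mathcal{H}$-Ramsey.
   Context: A triple $(\mathcal{R},\leq,r)$ consists of a set $\mathcal{R}$, a quasi order $\leq$ on $\mathcal{R}$ and a function $r:\mathbb{N}\times\mathcal{R}\to\mathcal{AR}$ with range $\mathcal{AR}$; write $r_n(A)=r(n,A)$ and $\mathcal{AR}_n=\{r_n(A):A\in\mathcal{R}\}$. Assume: (A.1) $r_0(A)=\emptyset$ for all $A$; (A.2) if $A\neq B$ then $r_n(A)\neq r_n(B)$ for some $n$; (A.3) if $r_n(A)=r_m(B)$ then $n=m$ and $r_i(A)=r_i(B)$ for all $i<n$. For $a\in\mathcal{AR}$, $|a|$ is the unique $n$ with $a=r_n(A)$ for some $A$. For $a\in\mathcal{AR}$, $A\in\mathcal{R}$ let $[a,A]=\{B\in\mathcal{R}:\exists n\,(r_n(B)=a)\text{ and }B\leq A\}$; $a$ is compatible with $A$ if $[a,A]\neq\emptyset$; $\mathcal{AR}(A)$ is the set of $a$ compatible with $A$; $[n,A]=[r_n(A),A]$; $r_{k}([a,B])=\{r_k(C):C\in[a,B]\}$.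 Identifying $A$ with $(r_n(A))_n$, $\mathcal{R}$ is a subspace of $\mathcal{AR}^{\mathbb{N}}$ ($\mathcal{AR}$ discrete, product topology); $\mathcal{R}$ is metrically closed if it is closed there. (A.4) There is a quasi order $\leq_{fin}$ on $\mathcal{AR}$ with: $A\leq B$ iff $\forall n\exists m\ r_n(A)\leq_{fin}r_m(B)$; and $\{b:b\leq_{fin}a\}$ is finite for each $a$. $depth_A(a)$ is the least $n$ with $a\leq_{fin}r_n(A)$. (A.5) For compatible $a,A$ with $depth_A(a)=n$: (i) $[a,B]\neq\emptyset$ for all $B\in[n,A]$; (ii) for all $B\in[a,A]$ there is $A'\in[n,A]$ with $[a,A']\subseteq[a,B]$. (A.6) For compatible $a,A$ with $depth_A(a)=n$ and any $\phi:\mathcal{AR}_{|a|+1}\to\{0,1\}$ there is $B\in[n,A]$ with $\phi$ constant on $r_{|a|+1}([a,B])$. A topological Ramsey space is such a triple satisfying (A.1)–(A.6) with $\mathcal{R}$ metrically closed. For $\mathcal{H}\subseteq\mathcal{R}$ and $A\in\mathcal{R}$, $\mathcal{H}\!\upharpoonright\! A=\{B\in\mathcal{H}:B\leq A\}$. $\mathcal{H}$ is a coideal if: (1) $A\leq B$, $A\in\mathcal{H}$ imply $B\in\mathcal{H}$; (2) for $A\in\mathcal{H}$, $a\in\mathcal{AR}(A)$, $n=depth_A(a)$: (i) for all $B\in[n,A]\cap\mathcal{H}$, $[a,B]\cap\mathcal{H}\neq\emptyset$; (ii) for all $B\in[a,A]\cap\mathcal{H}$ there is $A'\in[n,A]\cap\mathcal{H}$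 with $[a,A']\subseteq[a,B]$; (3) for $a\in\mathcal{AR}$ of length $l$, $\mathcal{O}\subseteq\mathcal{AR}_{l+1}$ and every $A\in\mathcal{H}$ with $[a,A]\neq\emptyset$ there is $B\in[depth_A(a),A]\cap\mathcal{H}$ with $r_{l+1}([a,B])\subseteq\mathcal{O}$ or $r_{l+1}([a,B])\subseteq\mathcal{AR}_{l+1}\setminus\mathcal{O}$. A coideal $\mathcal{H}$ is selective if for every $A\in\mathcal{H}$, $\mathcal{I}\subseteq\mathcal{AR}$ and family $(A_a)_{a\in\mathcal{I}}$ with $A_a\in\mathcal{H}\!\upharpoonright\! A$ and $[a,A_a]\neq\emptyset$, there is $B\in\mathcal{H}\!\upharpoonright\! A$ with $[a,B]\subseteq[a,A_a]$ for all $a\in\mathcal{I}\cap\mathcal{AR}(B)$. $\mathcal{X}\subseteq\mathcal{R}$ is $\mathcal{H}$-Ramsey if for every $[a,A]\neq\emptyset$ with $A\in\mathcal{H}$ there exists $B\in[a,A]\cap\mathcal{H}$ with $[a,B]\neq\emptyset$ such that $[a,B]\subseteq\mathcal{X}$ or $[a,B]\subseteq\mathcal{R}\setminus\mathcal{X}$. *)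

theory Defs
  imports "HOL-Analysis.Analysis"
begin

text \<open>
  The basic data: a carrier \<open>R\<close> with a relation \<open>\<preceq>\<close>, the approximation maps \<open>r\<close>, and the
  relation \<open>\<preceq>\<^sub>f\<close> on approximations. The notions depending on \<open>depth\<close> depend on \<open>\<preceq>\<^sub>f\<close>,
  so \<open>\<preceq>\<^sub>f\<close> is part of the structure rather than existentially quantified.
\<close>

locale ramsey_structure =
  fixes R :: "'a set"
    and le :: "'a \<Rightarrow> 'a \<Rightarrow> bool"  (infix \<open>\<preceq>\<close> 50)
    and r :: "nat \<Rightarrow> 'a \<Rightarrow> 'b"
    and lefin :: "'b \<Rightarrow> 'b \<Rightarrow> bool"  (infix \<open>\<preceq>\<^sub>f\<close> 50)
begin

definition AR :: "'b set" where
  "AR = {r n A | n A. A \<in> R}"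

definition AR_at :: "nat \<Rightarrow> 'b set" where
  "AR_at n = {r n A | A. A \<in> R}"

definition len :: "'b \<Rightarrow> nat" where
  "len a = (THE n. \<exists>A\<in>R. a = r n A)"

definition basic :: "'b \<Rightarrow> 'a \<Rightarrow> 'a set" where
  "basic a A = {B \<in> R. (\<exists>n. r n B = a) \<and> B \<preceq> A}"

definition basic_at :: "nat \<Rightarrow> 'a \<Rightarrow> 'a set" where
  "basic_at n A = basic (r n A) A"

definition compatible :: "'b \<Rightarrow> 'a \<Rightarrow> bool" where
  "compatible a A \<longleftrightarrow> basic a A \<noteq> {}"

definition AR_below :: "'a \<Rightarrow> 'b set" where
  "AR_below A = {a \<in> AR. compatible a A}"

text \<open>For \<open>a\<close> compatible with \<open>A\<close>, (A.4) guarantees that the least element exists.\<close>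

definition depth :: "'a \<Rightarrow> 'b \<Rightarrow> nat" where
  "depth A a = (LEAST n. a \<preceq>\<^sub>f r n A)"

definition metrically_closed :: bool where
  "metrically_closed \<longleftrightarrow>
     closedin (product_topology (\<lambda>n::nat. discrete_topology AR) UNIV) ((\<lambda>A n. r n A) ` R)"

definition restrict_below :: "'a set \<Rightarrow> 'a \<Rightarrow> 'a set" where
  "restrict_below H A = {B \<in> H. B \<preceq> A}"

definition coideal :: "'a set \<Rightarrow> bool" where
  "coideal H \<longleftrightarrow>
     H \<subseteq> R \<and>
     (\<forall>A\<in>R. \<forall>B\<in>R. A \<preceq> B \<longrightarrow> A \<in> H \<longrightarrow> B \<in> H) \<and>
     (\<forall>A\<in>H. \<forall>a\<in>AR_below A.
        (\<forall>B \<in> basic_at (depth A a) A \<inter> H. basic a B \<inter> H \<noteq> {}) \<and>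
        (\<forall>B \<in> basic a A \<inter> H. \<exists>A' \<in> basic_at (depth A a) A \<inter> H. basic a A' \<subseteq> basic a B)) \<and>
     (\<forall>a\<in>AR. \<forall>O1 \<subseteq> AR_at (len a + 1). \<forall>A\<in>H. basic a A \<noteq> {} \<longrightarrow>
        (\<exists>B \<in> basic_at (depth A a) A \<inter> H.
           r (len a + 1) ` basic a B \<subseteq> O1 \<or>
           r (len a + 1) ` basic a B \<subseteq> AR_at (len a + 1) - O1))"

definition selective_coideal :: "'a set \<Rightarrow> bool" where
  "selective_coideal H \<longleftrightarrow>
     coideal H \<and>
     (\<forall>A\<in>H. \<forall>I \<subseteq> AR. \<forall>F :: 'b \<Rightarrow> 'a.
        (\<forall>a\<in>I. F a \<in> restrict_below H A \<and> basic a (F a) \<noteq> {}) \<longrightarrow>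
        (\<exists>B \<in> restrict_below H A. \<forall>a \<in> I \<inter> AR_below B. basic a B \<subseteq> basic a (F a)))"

definition ramsey_wrt :: "'a set \<Rightarrow> 'a set \<Rightarrow> bool" where
  "ramsey_wrt H X \<longleftrightarrow>
     X \<subseteq> R \<and>
     (\<forall>a\<in>AR. \<forall>A\<in>H. basic a A \<noteq> {} \<longrightarrow>
        (\<exists>B \<in> basic a A \<inter> H. basic a B \<noteq> {} \<and> (basic a B \<subseteq> X \<or> basic a B \<subseteq> R - X)))"

end

text \<open>\<open>emp\<close> is the common approximation of length zero, usually written as the empty set.\<close>

locale topological_ramsey_space = ramsey_structure R le r lefin
  for R :: "'a set"
    and le :: "'a \<Rightarrow> 'a \<Rightarrow> bool"  (infix \<open>\<preceq>\<close> 50)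
    and r :: "nat \<Rightarrow> 'a \<Rightarrow> 'b"
    and lefin :: "'b \<Rightarrow> 'b \<Rightarrow> bool"  (infix \<open>\<preceq>\<^sub>f\<close> 50) +
  fixes emp :: 'b
  assumes le_refl: "reflp_on R (\<preceq>)"
    and le_trans: "transp_on R (\<preceq>)"
    and A1: "A \<in> R \<Longrightarrow> r 0 A = emp"
    and A2: "\<lbrakk>A \<in> R; B \<in> R; A \<noteq> B\<rbrakk> \<Longrightarrow> \<exists>n. r n A \<noteq> r n B"
    and A3: "\<lbrakk>A \<in> R; B \<in> R; r n A = r m B\<rbrakk> \<Longrightarrow> n = m \<and> (\<forall>i<n. r i A = r i B)"
    and lefin_refl: "reflp_on AR (\<preceq>\<^sub>f)"
    and lefin_trans: "transp_on AR (\<preceq>\<^sub>f)"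
    and A4_le: "\<lbrakk>A \<in> R; B \<in> R\<rbrakk> \<Longrightarrow> A \<preceq> B \<longleftrightarrow> (\<forall>n. \<exists>m. r n A \<preceq>\<^sub>f r m B)"
    and A4_finite: "a \<in> AR \<Longrightarrow> finite {b \<in> AR. b \<preceq>\<^sub>f a}"
    and A5_i: "\<lbrakk>a \<in> AR; A \<in> R; compatible a A; B \<in> basic_at (depth A a) A\<rbrakk>
                 \<Longrightarrow> basic a B \<noteq> {}"
    and A5_ii: "\<lbrakk>a \<in> AR; A \<in> R; compatible a A; B \<in> basic a A\<rbrakk>
                 \<Longrightarrow> \<exists>A' \<in> basic_at (depth A a) A. basic a A' \<subseteq> basic a B"
    and A6: "\<lbrakk>a \<in> AR; A \<in> R; compatible a A; \<phi> \<in> AR_at (len a + 1) \<rightarrow> {0, 1::nat}\<rbrakk>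
                 \<Longrightarrow> \<exists>B \<in> basic_at (depth A a) A. \<phi> constant_on (r (len a + 1) ` basic a B)"
    and closed: "metrically_closed"

definition souslin :: "(nat list \<Rightarrow> 'a set) \<Rightarrow> 'a set" where
  "souslin X = (\<Union>x :: nat \<Rightarrow> nat. \<Inter>n. X (map x [0..<n]))"

end

theory Submission
  imports Defs
begin

text \<open>
  Selectivity only produces some \<open>B \<preceq> A\<close> in \<open>H\<close>, which need not be compatible with a prescribed
  approximation \<open>a\<close>. The fusion lemma repairs this: along the initial segments of \<open>B\<close> one builds a
  fusion sequence of members of \<open>H\<close> whose limit \<open>C\<close> keeps a prescribed initial segment of \<open>A\<close> and
  lies above \<open>B\<close>; so \<open>C \<in> H\<close> by upward closure. Thus every dense hereditary requirement on pairs
  \<open>(c, E)\<close> can be met by one \<open>C \<in> [a, A] \<inter> H\<close> for all but finitely many \<open>c\<close>. Accept/reject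
  arguments then show that metrically open sets are Ramsey and that Ramsey sets form a
  \<open>\<sigma>\<close>-algebra. For the Souslin operation, the sets \<open>Y\<^sub>s\<close> obtained from the branches through \<open>s\<close>
  have metrically closed envelopes \<open>\<Psi>\<^sub>s\<close>, and outside the countably many nowhere dense sets
  \<open>\<Psi>\<^sub>s - X\<^sub>s \<inter> (\<Union>k. \<Psi>\<^sub>s\<^sub>k)\<close> the Souslin set coincides with its envelope.
\<close>

locale selective_ramsey_space = topological_ramsey_space +
  fixes H :: "'a set"
  assumes selective: "selective_coideal H"
begin

section \<open>Basic sets, initial segments and depth\<close>

lemma mem_basic: "B \<in> basic a A \<longleftrightarrow> B \<in> R \<and> (\<exists>n. r n B = a) \<and> B \<preceq> A"
  by (simp add: basic_def)

lemma le_reflexive: "A \<in> R \<Longrightarrow> A \<preceq> A"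
  using le_refl by (rule reflp_onD)

lemma le_transitive: "\<lbrakk>A \<preceq> B; B \<preceq> C; A \<in> R; B \<in> R; C \<in> R\<rbrakk> \<Longrightarrow> A \<preceq> C"
  using le_trans by (rule transp_onD)

lemma r_in_AR: "A \<in> R \<Longrightarrow> r n A \<in> AR"
  by (auto simp: AR_def)

lemma r_eq_length: "\<lbrakk>A \<in> R; B \<in> R; r n A = r m B\<rbrakk> \<Longrightarrow> n = m"
  using A3[of A B n m] by blast

lemma r_eq_initial: "\<lbrakk>A \<in> R; B \<in> R; r n A = r m B; i \<le> n\<rbrakk> \<Longrightarrow> r i A = r i B"
  using A3[of A B n m] by (cases "i = n") auto

lemma len_r: "A \<in> R \<Longrightarrow> len (r n A) = n"
  unfolding len_def by (rule the_equality) (auto dest: r_eq_length)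

lemma basic_nonempty_AR: "basic c E \<noteq> {} \<Longrightarrow> c \<in> AR"
  by (auto simp: mem_basic r_in_AR)

lemma mem_basic_self: "A \<in> R \<Longrightarrow> A \<in> basic (r n A) A"
  by (auto simp: mem_basic le_reflexive)

lemma mem_basic_r: "D \<in> basic c E \<Longrightarrow> r (len c) D = c"
  by (auto simp: mem_basic len_r)

lemma basic_restrict:
  assumes "E' \<preceq> E" "E \<in> R" "E' \<in> R"
  shows "basic c E' = {D \<in> basic c E. D \<preceq> E'}"
  using le_transitive[OF _ assms(1) _ assms(3,2)] by (auto simp: mem_basic)

lemma basic_mono: "\<lbrakk>E' \<preceq> E; E \<in> R; E' \<in> R\<rbrakk> \<Longrightarrow> basic c E' \<subseteq> basic c E"
  by (simp add: basic_restrict)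

lemma basic_extend:
  assumes "D \<in> basic c E" "len c \<le> k"
  shows "basic (r k D) E \<subseteq> basic c E"
proof
  fix C assume "C \<in> basic (r k D) E"
  then obtain n where C: "C \<in> R" "C \<preceq> E" "r n C = r k D"
    by (auto simp: mem_basic)
  have D: "D \<in> R" "r (len c) D = c"
    using assms(1) mem_basic_r by (auto simp: mem_basic)
  have "r (len c) D = r (len c) C"
    using r_eq_initial[OF D(1) C(1) C(3)[symmetric] assms(2)] .
  then show "C \<in> basic c E"
    using C D(2) mem_basic by metis
qed

lemma mem_basic_at:
  assumes "E \<in> R"
  shows "E' \<in> basic_at d E \<longleftrightarrow> E' \<in> R \<and> E' \<preceq> E \<and> (\<forall>i\<le>d. r i E' = r i E)"
proof
  assume "E' \<in> basic_at d E"
  then have E': "E' \<in> R" "E' \<preceq> E" and "\<exists>n. r n E' = r d E"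
    unfolding basic_at_def mem_basic by blast+
  then obtain n where n: "r n E' = r d E"
    by blast
  have "r i E' = r i E" if "i \<le> d" for i
    using r_eq_initial[OF E'(1) assms n, of i] r_eq_length[OF E'(1) assms n] that by blast
  then show "E' \<in> R \<and> E' \<preceq> E \<and> (\<forall>i\<le>d. r i E' = r i E)"
    using E' by blast
next
  assume "E' \<in> R \<and> E' \<preceq> E \<and> (\<forall>i\<le>d. r i E' = r i E)"
  then have "r d E' = r d E" "E' \<in> R" "E' \<preceq> E"
    by auto
  then show "E' \<in> basic_at d E"
    unfolding basic_at_def mem_basic by blast
qed

lemma basic_at_refl: "E \<in> R \<Longrightarrow> E \<in> basic_at d E"
  by (simp add: mem_basic_at le_reflexive)

lemma basic_atD:
  assumes "E' \<in> basic_at d E" "E \<in> R"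
  shows "E' \<in> R" "E' \<preceq> E" "\<And>i. i \<le> d \<Longrightarrow> r i E' = r i E"
  using assms by (simp_all add: mem_basic_at)

lemma basic_at_trans:
  assumes "E \<in> R" "E' \<in> basic_at d E" "E'' \<in> basic_at d' E'" "d \<le> d'"
  shows "E'' \<in> basic_at d E"
proof -
  note E' = basic_atD[OF assms(2,1)]
  note E'' = basic_atD[OF assms(3) E'(1)]
  have "E'' \<preceq> E"
    using le_transitive[OF E''(2) E'(2) E''(1) E'(1) assms(1)] .
  moreover have "r i E'' = r i E" if "i \<le> d" for i
    using E'(3) E''(3) that assms(4) by simp
  ultimately show ?thesis
    using E''(1) mem_basic_at[OF assms(1)] by blast
qed

lemma basic_at_basic_mono: "\<lbrakk>E \<in> R; E' \<in> basic_at d E\<rbrakk> \<Longrightarrow> basic c E' \<subseteq> basic c E"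
  by (rule basic_mono) (auto simp: mem_basic_at)

lemma lefin_depth:
  assumes "E \<in> R" "basic c E \<noteq> {}"
  shows "c \<preceq>\<^sub>f r (depth E c) E"
proof -
  obtain D n where "D \<in> R" "r n D = c" "D \<preceq> E"
    using assms(2) mem_basic by blast
  then obtain m where "c \<preceq>\<^sub>f r m E"
    using A4_le[of D E] assms(1) by blast
  then show ?thesis
    unfolding depth_def by (rule LeastI)
qed

lemma depth_le: "c \<preceq>\<^sub>f r i E \<Longrightarrow> depth E c \<le> i"
  unfolding depth_def by (rule Least_le)

text \<open>The least witness for \<open>E\<close> has index at most \<open>d\<close>, so it is
  shared with \<open>E'\<close>; the least witness for \<open>E'\<close> is then at most as large
  and is shared back.\<close>

lemma depth_agree:
  assumes "E \<in> R" "\<And>i. i \<le> d \<Longrightarrow> r i E' = r i E" "basic c E \<noteq> {}" "depth E c \<le> d"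
  shows "depth E' c = depth E c"
proof -
  have "c \<preceq>\<^sub>f r (depth E c) E'"
    using lefin_depth[OF assms(1,3)] assms(2,4) by simp
  then have "depth E' c \<le> depth E c" "c \<preceq>\<^sub>f r (depth E' c) E'"
    unfolding depth_def[of E'] by (auto intro: Least_le LeastI)
  then show ?thesis
    using assms(2,4) depth_le[of c "depth E' c" E] by fastforce
qed

lemma depth_basic_at:
  assumes "E \<in> R" "E' \<in> basic_at d E"
  shows "\<lbrakk>basic c E \<noteq> {}; depth E c \<le> d\<rbrakk> \<Longrightarrow> depth E' c = depth E c"
    and "\<lbrakk>basic c E' \<noteq> {}; depth E' c \<le> d\<rbrakk> \<Longrightarrow> depth E' c = depth E c"
proof -
  note E' = basic_atD[OF assms(2,1)]
  show "\<lbrakk>basic c E \<noteq> {}; depth E c \<le> d\<rbrakk> \<Longrightarrow> depth E' c = depth E c"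
    using depth_agree[OF assms(1), of d E' c] E'(3) by blast
  show "\<lbrakk>basic c E' \<noteq> {}; depth E' c \<le> d\<rbrakk> \<Longrightarrow> depth E' c = depth E c"
    using depth_agree[OF E'(1), of d E c] E'(3) by metis
qed

text \<open>By (A.4) each of the finitely many \<open>r i E\<close> has finitely many predecessors.
  This is the source of the finiteness of a single depth level and of the sets of exceptions
  below.\<close>

lemma finite_depth_le:
  assumes "E \<in> R"
  shows "finite {c. basic c E \<noteq> {} \<and> depth E c \<le> d}"
proof (rule finite_subset)
  show "{c. basic c E \<noteq> {} \<and> depth E c \<le> d} \<subseteq> (\<Union>i\<le>d. {c \<in> AR. c \<preceq>\<^sub>f r i E})"
    using lefin_depth[OF assms] basic_nonempty_AR by auto
  show "finite (\<Union>i\<le>d. {c \<in> AR. c \<preceq>\<^sub>f r i E})"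
    using A4_finite r_in_AR[OF assms] by auto
qed

lemma basic_emp: "E \<in> R \<Longrightarrow> E \<in> basic emp E"
  using mem_basic_self[of E 0] A1 by simp

lemma depth_emp: "E \<in> R \<Longrightarrow> depth E emp = 0"
  using depth_le[of emp 0 E] A1 lefin_refl r_in_AR[of E 0] by (auto simp: reflp_on_def)

section \<open>Limits from metric closedness\<close>

lemma closed_limit:
  assumes "\<And>n. \<exists>A\<in>R. \<forall>i\<le>n. r i A = f i"
  shows "\<exists>C\<in>R. \<forall>i. r i C = f i"
proof -
  let ?T = "product_topology (\<lambda>n::nat. discrete_topology AR) UNIV"
  let ?S = "(\<lambda>A n. r n A) ` R"
  have fAR: "f i \<in> AR" for i
    using assms[of i] r_in_AR by (metis order_refl)
  have "f \<in> ?S"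
  proof (rule ccontr)
    assume "f \<notin> ?S"
    then have f: "f \<in> topspace ?T - ?S"
      using fAR by (simp add: PiE_iff)
    have "openin ?T (topspace ?T - ?S)"
      using closed unfolding metrically_closed_def closedin_def by blast
    from bspec[OF this[unfolded openin_product_topology_alt] f]
    obtain U where "finite {i \<in> UNIV. U i \<noteq> topspace (discrete_topology AR)}"
        "f \<in> Pi\<^sub>E UNIV U" "Pi\<^sub>E UNIV U \<subseteq> topspace ?T - ?S"
      by blast
    then have U: "finite {i. U i \<noteq> AR}" "\<And>i. f i \<in> U i" "Pi\<^sub>E UNIV U \<subseteq> - ?S"
      by auto
    obtain N where N: "\<And>i. U i \<noteq> AR \<Longrightarrow> i \<le> N"
      using U(1) unfolding finite_nat_set_iff_bounded_le by auto
    \<comment> \<open>The neighbourhood of \<open>f\<close> restricts only coordinates up to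
      \<open>N\<close>, so a member of \<open>R\<close> agreeing with \<open>f\<close> that far lies
      in it.\<close>
    obtain A where A: "A \<in> R" "\<And>i. i \<le> N \<Longrightarrow> r i A = f i"
      using assms by blast
    have "r i A \<in> U i" for i
      using N[of i] A(2)[of i] U(2)[of i] r_in_AR[OF A(1), of i] by (cases "U i = AR") auto
    then have "(\<lambda>i. r i A) \<in> (\<Pi>\<^sub>E i\<in>UNIV. U i)"
      by auto
    then show False
      using U(3) A(1) by blast
  qed
  then obtain C where "C \<in> R" "f = (\<lambda>n. r n C)"
    by blast
  then show ?thesis
    by blast
qed

text \<open>The \<open>i\<close>-th approximation is constant from stage \<open>J i\<close> on, so
  metric closedness supplies \<open>C\<close>. Each \<open>r i C\<close> is an approximation of a
  later \<open>E k\<close>, which lies below \<open>E j\<close>; hence \<open>C\<close> lies below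
  \<open>E j\<close> by (A.4).\<close>

lemma fusion_limit:
  fixes E :: "nat \<Rightarrow> 'a" and e :: "nat \<Rightarrow> nat"
  assumes R: "\<And>j. E j \<in> R"
    and step: "\<And>j. E (Suc j) \<in> basic_at (e j) (E j)"
    and mono: "\<And>j. e j \<le> e (Suc j)"
    and unbounded: "\<And>i. \<exists>j. i \<le> e j"
  shows "\<exists>C\<in>R. \<forall>j. C \<in> basic_at (e j) (E j)"
proof -
  have e_mono: "e j \<le> e k" if "j \<le> k" for j k
    using mono that by (rule lift_Suc_mono_le)
  have later: "E k \<in> basic_at (e j) (E j)" if "j \<le> k" for j k
    using that
  proof (induction k rule: dec_induct)
    case base
    then show ?case by (rule basic_at_refl[OF R])
  next
    case (step k)
    then show ?case
      using basic_at_trans[OF R _ assms(2)[of k]] e_mono by blast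
  qed
  define J where "J i = (LEAST j. i \<le> e j)" for i
  have J: "i \<le> e (J i)" for i
    unfolding J_def using unbounded by (rule LeastI_ex)
  have agree: "r i (E j) = r i (E (J i))" if "i \<le> e j" for i j
  proof -
    have "J i \<le> j"
      unfolding J_def using that by (rule Least_le)
    then show ?thesis
      using basic_atD(3)[OF later R, of "J i" j i] J[of i] by blast
  qed
  have "\<exists>A\<in>R. \<forall>i\<le>n. r i A = r i (E (J i))" for n
    using R[of "J n"] agree[of _ "J n"] order.trans[OF _ J[of n]] by blast
  then obtain C where C: "C \<in> R" "\<And>i. r i C = r i (E (J i))"
    using closed_limit[of "\<lambda>i. r i (E (J i))"] by blast
  have "C \<in> basic_at (e j) (E j)" for j
  proof -
    have "\<exists>m. r i C \<preceq>\<^sub>f r m (E j)" for i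
    proof -
      define k where "k = max j (J i)"
      have "i \<le> e k"
        using J[of i] e_mono[of "J i" k] by (simp add: k_def)
      then have "r i C = r i (E k)"
        using C(2)[of i] agree[of i k] by simp
      moreover have "E k \<preceq> E j"
        using basic_atD(2)[OF later R, of j k] by (simp add: k_def)
      ultimately show ?thesis
        using A4_le[OF R[of k] R[of j]] by simp
    qed
    then have "C \<preceq> E j"
      using A4_le[OF C(1) R[of j]] by blast
    moreover have "r i C = r i (E j)" if "i \<le> e j" for i
      using C(2)[of i] agree[OF that] by simp
    ultimately show ?thesis
      using C(1) mem_basic_at[OF R] by blast
  qed
  then show ?thesis
    using C(1) by blast
qed

section \<open>The coideal axioms in usable form\<close>

lemma coideal: "coideal H"
  using selective by (simp add: selective_coideal_def)

lemma H_R: "E \<in> H \<Longrightarrow> E \<in> R"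
  using coideal unfolding coideal_def by blast

lemma H_upward:
  assumes "B \<in> H" "B \<preceq> C" "C \<in> R"
  shows "C \<in> H"
proof -
  have "\<forall>A\<in>R. \<forall>B\<in>R. A \<preceq> B \<longrightarrow> A \<in> H \<longrightarrow> B \<in> H"
    using coideal unfolding coideal_def by blast
  then show ?thesis
    using assms H_R by blast
qed

lemma AR_below_iff: "c \<in> AR_below E \<longleftrightarrow> basic c E \<noteq> {}"
  using basic_nonempty_AR by (auto simp: AR_below_def compatible_def)

lemma coideal_basic:
  assumes "E \<in> H" "basic c E \<noteq> {}" "B \<in> basic_at (depth E c) E" "B \<in> H"
  shows "\<exists>D \<in> H. D \<in> basic c B"
proof -
  have "\<forall>A\<in>H. \<forall>a\<in>AR_below A. \<forall>B \<in> basic_at (depth A a) A \<inter> H. basic a B \<inter> H \<noteq> {}"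
    using coideal unfolding coideal_def by blast
  then have "basic c B \<inter> H \<noteq> {}"
    using assms by (simp add: AR_below_iff)
  then show ?thesis
    by blast
qed

lemma coideal_basic_self:
  "\<lbrakk>E \<in> H; basic c E \<noteq> {}\<rbrakk> \<Longrightarrow> \<exists>D \<in> H. D \<in> basic c E"
  using coideal_basic[of E c E] basic_at_refl H_R by blast

lemma coideal_amalgamation:
  assumes "E \<in> H" "B \<in> basic c E" "B \<in> H"
  shows "\<exists>E' \<in> H. E' \<in> basic_at (depth E c) E \<and> basic c E' \<subseteq> basic c B"
proof -
  have "\<forall>A\<in>H. \<forall>a\<in>AR_below A. \<forall>B \<in> basic a A \<inter> H.
      \<exists>A' \<in> basic_at (depth A a) A \<inter> H. basic a A' \<subseteq> basic a B"
    using coideal unfolding coideal_def by blast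
  moreover have "c \<in> AR_below E"
    using assms(2) AR_below_iff by blast
  ultimately have "\<exists>A' \<in> basic_at (depth E c) E \<inter> H. basic c A' \<subseteq> basic c B"
    using assms by (meson IntI)
  then show ?thesis
    by blast
qed

lemma coideal_pigeonhole:
  assumes "E \<in> H" "basic c E \<noteq> {}"
  shows "\<exists>E' \<in> H. E' \<in> basic_at (depth E c) E \<and>
    (r (Suc (len c)) ` basic c E' \<subseteq> P \<or> r (Suc (len c)) ` basic c E' \<inter> P = {})"
proof -
  let ?P = "P \<inter> AR_at (len c + 1)"
  have "\<forall>a\<in>AR. \<forall>O1 \<subseteq> AR_at (len a + 1). \<forall>A\<in>H. basic a A \<noteq> {} \<longrightarrow>
        (\<exists>B \<in> basic_at (depth A a) A \<inter> H.
           r (len a + 1) ` basic a B \<subseteq> O1 \<or>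
           r (len a + 1) ` basic a B \<subseteq> AR_at (len a + 1) - O1)"
    using coideal unfolding coideal_def by blast
  then have "\<exists>B \<in> basic_at (depth E c) E \<inter> H.
           r (len c + 1) ` basic c B \<subseteq> ?P \<or>
           r (len c + 1) ` basic c B \<subseteq> AR_at (len c + 1) - ?P"
    using assms basic_nonempty_AR[OF assms(2)] by (meson inf_le2)
  then show ?thesis
    by (auto simp: image_subset_iff disjoint_iff)
qed

section \<open>Dense hereditary requirements\<close>

definition hereditary :: "('b \<Rightarrow> 'a \<Rightarrow> bool) \<Rightarrow> bool" where
  "hereditary G \<longleftrightarrow> (\<forall>c. \<forall>E\<in>H. \<forall>E'\<in>H.
     G c E \<longrightarrow> basic c E' \<subseteq> basic c E \<longrightarrow> basic c E' \<noteq> {} \<longrightarrow> G c E')"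

definition dense_below :: "'a \<Rightarrow> ('b \<Rightarrow> 'a \<Rightarrow> bool) \<Rightarrow> bool" where
  "dense_below A G \<longleftrightarrow>
     (\<forall>E\<in>H. E \<preceq> A \<longrightarrow> (\<forall>c. basic c E \<noteq> {} \<longrightarrow> (\<exists>E'\<in>H. E' \<in> basic c E \<and> G c E')))"

definition good_at :: "('b \<Rightarrow> 'a \<Rightarrow> bool) \<Rightarrow> 'a \<Rightarrow> nat \<Rightarrow> bool" where
  "good_at G E d \<longleftrightarrow> (\<forall>c. basic c E \<noteq> {} \<longrightarrow> depth E c = d \<longrightarrow> G c E)"

lemma hereditaryD:
  "\<lbrakk>hereditary G; E \<in> H; E' \<in> H; G c E; basic c E' \<subseteq> basic c E; basic c E' \<noteq> {}\<rbrakk> \<Longrightarrow> G c E'"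
  unfolding hereditary_def by blast

lemma good_at_shrink:
  assumes "hereditary G" "good_at G E d" "E \<in> H" "E' \<in> H" "E' \<in> basic_at d' E" "d \<le> d'"
  shows "good_at G E' d"
  unfolding good_at_def
proof (intro allI impI)
  fix c assume c: "basic c E' \<noteq> {}" "depth E' c = d"
  have sub: "basic c E' \<subseteq> basic c E"
    using assms basic_at_basic_mono H_R by blast
  have "depth E c = depth E' c"
    using depth_basic_at(2)[OF H_R[OF assms(3)] assms(5) c(1)] c(2) assms(6) by simp
  then have "G c E"
    using assms(2) c sub by (auto simp: good_at_def)
  then show "G c E'"
    using hereditaryD[OF assms(1,3,4) _ sub c(1)] by blast
qed

text \<open>Only finitely many \<open>c\<close> have depth \<open>d\<close>, so they are treated one
  at a time. Amalgamation pulls a good \<open>D\<close> back to some \<open>F'\<close> that keeps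
  the first \<open>d\<close> approximations. It gives an inclusion of basic sets and not that
  \<open>F'\<close> is below \<open>D\<close>, which is why \<open>hereditary\<close> is phrased
  with inclusion.\<close>

lemma ex_good_at:
  assumes G: "hereditary G" "dense_below A G" and E: "E \<in> H" "E \<preceq> A" "A \<in> R"
  shows "\<exists>E'\<in>H. E' \<in> basic_at d E \<and> good_at G E' d"
proof -
  have *: "\<exists>E'\<in>H. E' \<in> basic_at d E \<and> (\<forall>c\<in>S. basic c E' \<noteq> {} \<longrightarrow> G c E')"
    if "finite S" "S \<subseteq> {c. basic c E \<noteq> {} \<and> depth E c = d}" for S
    using that
  proof (induction S)
    case empty
    then show ?case
      using E basic_at_refl H_R by blast
  next
    case (insert x S)
    then obtain F where F: "F \<in> H" "F \<in> basic_at d E" "\<And>c. \<lbrakk>c \<in> S; basic c F \<noteq> {}\<rbrakk> \<Longrightarrow> G c F"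
      by auto
    have FR: "F \<in> R" "E \<in> R" using F E H_R by auto
    show ?case
    proof (cases "basic x F = {}")
      case True
      then show ?thesis using F by blast
    next
      case False
      have dx: "depth F x = d"
        using depth_basic_at(1)[OF FR(2) F(2), of x] insert.prems by simp
      have "F \<preceq> A"
        using le_transitive[OF basic_atD(2)[OF F(2) FR(2)] E(2) FR E(3)] .
      then obtain D where D: "D \<in> H" "D \<in> basic x F" "G x D"
        using G(2) False F(1) unfolding dense_below_def by blast
      obtain F' where F': "F' \<in> H" "F' \<in> basic_at d F" "basic x F' \<subseteq> basic x D"
        using coideal_amalgamation[OF F(1) D(2,1)] dx by auto
      have "F' \<in> basic_at d E"
        using basic_at_trans F' F FR by blast
      moreover have "G c F'" if "c \<in> insert x S" "basic c F' \<noteq> {}" for c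
      proof (cases "c = x")
        case True
        then show ?thesis
          using hereditaryD[OF G(1) D(1) F'(1) D(3)] F'(3) that by blast
      next
        case False
        have sub: "basic c F' \<subseteq> basic c F"
          using basic_at_basic_mono F' FR by blast
        then have "G c F"
          using False that F(3) by blast
        then show ?thesis
          using hereditaryD[OF G(1) F(1) F'(1) _ sub] that by blast
      qed
      ultimately show ?thesis
        using F'(1) by blast
    qed
  qed
  have ER: "E \<in> R" using E H_R by blast
  have "finite {c. basic c E \<noteq> {} \<and> depth E c = d}"
    by (rule finite_subset[OF _ finite_depth_le[OF ER, of d]]) auto
  then obtain E' where E': "E' \<in> H" "E' \<in> basic_at d E"
    "\<And>c. \<lbrakk>basic c E \<noteq> {}; depth E c = d; basic c E' \<noteq> {}\<rbrakk> \<Longrightarrow> G c E'"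
    using *[of "{c. basic c E \<noteq> {} \<and> depth E c = d}"] by blast
  have "good_at G E' d"
    unfolding good_at_def
  proof (intro allI impI)
    fix c assume c: "basic c E' \<noteq> {}" "depth E' c = d"
    have "basic c E \<noteq> {}"
      using basic_at_basic_mono[OF ER E'(2)] c by blast
    moreover have "depth E c = depth E' c"
      using depth_basic_at(2)[OF ER E'(2) c(1)] c(2) by simp
    ultimately show "G c E'"
      using E'(3) c by auto
  qed
  then show ?thesis
    using E' by blast
qed

section \<open>Active states of the fusion\<close>

text \<open>
  A state \<open>(b, E, e)\<close> of the fusion: \<open>b\<close> approximates the future \<open>B\<close>, and the first \<open>e\<close>
  approximations of \<open>E\<close> are frozen. The axioms do not make \<open>depth\<close> monotone along initial segments,
  so an auxiliary \<open>b0\<close> carries the depth \<open>e\<close> that the coideal axioms allow to preserve.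
\<close>

definition active :: "'b \<Rightarrow> 'a \<Rightarrow> nat \<Rightarrow> bool" where
  "active b E e \<longleftrightarrow> E \<in> H \<and> basic b E \<noteq> {} \<and> depth E b \<le> e \<and>
     (\<exists>b0. depth E b0 = e \<and> basic b0 E = basic b E)"

lemma active_depth: "\<lbrakk>E \<in> H; basic b E \<noteq> {}\<rbrakk> \<Longrightarrow> active b E (depth E b)"
  by (auto simp: active_def)

text \<open>\<open>A5_i\<close> applies to \<open>b0\<close>, whose depth is exactly
  \<open>e\<close>, and \<open>b0\<close> has the same basic sets as \<open>b\<close> below
  \<open>E\<close>. Since this is an axiom of the space, \<open>E'\<close> may lie outside
  \<open>H\<close>.\<close>

lemma active_compatible:
  assumes "active b E e" "E' \<in> basic_at e E"
  shows "basic b E' \<noteq> {}"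
proof -
  obtain b0 where b0: "depth E b0 = e" "basic b0 E = basic b E" "basic b E \<noteq> {}" "E \<in> R"
    using assms(1) H_R unfolding active_def by blast
  then have "basic b0 E' \<noteq> {}"
    using A5_i[of b0 E E'] basic_nonempty_AR[of b0 E] assms(2) by (auto simp: compatible_def)
  moreover have "basic b0 E' = basic b E'"
    using basic_restrict[OF basic_atD(2)[OF assms(2) b0(4)] b0(4) basic_atD(1)[OF assms(2) b0(4)]] b0(2)
    by simp
  ultimately show ?thesis by simp
qed

lemma active_shrink:
  assumes "active b E e" "E' \<in> basic_at e E" "E' \<in> H"
  shows "active b E' e"
proof -
  obtain b0 where b0: "depth E b0 = e" "basic b0 E = basic b E" "basic b E \<noteq> {}" "E \<in> R" "depth E b \<le> e"
    using assms(1) H_R unfolding active_def by blast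
  have "basic b0 E' = basic b E'"
    using basic_restrict[OF basic_atD(2)[OF assms(2) b0(4)] b0(4) basic_atD(1)[OF assms(2) b0(4)]] b0(2)
    by simp
  moreover have "depth E' b0 = e" "depth E' b \<le> e"
    using depth_basic_at(1)[OF b0(4) assms(2), of b0] depth_basic_at(1)[OF b0(4) assms(2), of b] b0
    by simp_all
  ultimately show ?thesis
    using active_compatible[OF assms(1,2)] assms(3) by (auto simp: active_def)
qed

text \<open>The coideal pigeonhole preserves \<open>E\<close> only up to \<open>depth E b\<close>,
  possibly less than \<open>e\<close>. A point \<open>D\<close> of the homogeneous basic set is
  therefore amalgamated back through \<open>b0\<close>, which preserves \<open>E\<close> up to
  \<open>e\<close>.\<close>

lemma active_pigeonhole:
  assumes "active b E e"
  shows "\<exists>E' \<in> H. E' \<in> basic_at e E \<and>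
    (r (Suc (len b)) ` basic b E' \<subseteq> P \<or> r (Suc (len b)) ` basic b E' \<inter> P = {})"
proof -
  obtain b0 where b0: "depth E b0 = e" "basic b0 E = basic b E" "basic b E \<noteq> {}" "E \<in> H" "E \<in> R"
    using assms H_R unfolding active_def by blast
  obtain F where F: "F \<in> H" "F \<in> basic_at (depth E b) E"
    "r (Suc (len b)) ` basic b F \<subseteq> P \<or> r (Suc (len b)) ` basic b F \<inter> P = {}"
    using coideal_pigeonhole[OF b0(4,3)] by blast
  obtain D where D: "D \<in> H" "D \<in> basic b F"
    using coideal_basic[OF b0(4,3) F(2,1)] by blast
  have DE: "D \<in> basic b0 E"
    using D(2) basic_at_basic_mono[OF b0(5) F(2)] b0(2) by blast
  obtain E' where E': "E' \<in> H" "E' \<in> basic_at e E" "basic b0 E' \<subseteq> basic b0 D"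
    using coideal_amalgamation[OF b0(4) DE D(1)] b0(1) by blast
  have eq: "basic b0 E' = basic b E'"
    using basic_restrict[OF basic_atD(2)[OF E'(2) b0(5)] b0(5) basic_atD(1)[OF E'(2) b0(5)]] b0(2)
    by simp
  have "basic b E' \<subseteq> basic b F"
  proof
    fix C assume C: "C \<in> basic b E'"
    then have "C \<preceq> D" "C \<in> R" "\<exists>n. r n C = b"
      using E'(3) eq mem_basic by blast+
    moreover have "D \<preceq> F" using D by (auto simp: mem_basic)
    ultimately show "C \<in> basic b F"
      using le_transitive[of C D F] D F H_R by (auto simp: mem_basic)
  qed
  then show ?thesis
    using E' F(3) by blast
qed

text \<open>Pigeonhole against one successor \<open>x\<close> either leaves \<open>x\<close> alone
  or removes it. In the second case the number of successors drops, and some successor always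
  survives.\<close>

lemma active_singleton:
  assumes "active b E e" "finite (r (Suc (len b)) ` basic b E)"
  shows "\<exists>E' \<in> H. E' \<in> basic_at e E \<and> (\<exists>b'. r (Suc (len b)) ` basic b E' = {b'})"
  using assms
proof (induction "card (r (Suc (len b)) ` basic b E)" arbitrary: E rule: less_induct)
  case less
  let ?X = "\<lambda>E. r (Suc (len b)) ` basic b E"
  have ER: "E \<in> R" "E \<in> H" "basic b E \<noteq> {}"
    using less.prems H_R by (auto simp: active_def)
  then obtain x where x: "x \<in> ?X E" by blast
  show ?case
  proof (cases "?X E = {x}")
    case True
    then show ?thesis
      using ER basic_at_refl by blast
  next
    case False
    then obtain y where y: "y \<in> ?X E" "y \<noteq> x" using x by blast
    obtain F where F: "F \<in> H" "F \<in> basic_at e E" "?X F \<subseteq> {x} \<or> ?X F \<inter> {x} = {}"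
      using active_pigeonhole[OF less.prems(1)] by blast
    have "?X F \<subseteq> ?X E"
      using basic_at_basic_mono[OF ER(1) F(2)] by blast
    moreover have "?X F \<noteq> ?X E"
      using F(3) x y by blast
    ultimately have "?X F \<subset> ?X E" by blast
    then have "card (?X F) < card (?X E)" "finite (?X F)"
      using less.prems(2) by (auto intro: psubset_card_mono finite_subset)
    then obtain E' where "E' \<in> H" "E' \<in> basic_at e F" "\<exists>b'. ?X E' = {b'}"
      using less.hyps active_shrink[OF less.prems(1) F(2,1)] by blast
    then show ?thesis
      using basic_at_trans[OF ER(1) F(2)] by blast
  qed
qed

lemma basic_successor:
  assumes "D \<in> basic b E"
  shows "D \<in> basic (r (Suc (len b)) D) E" "basic (r (Suc (len b)) D) E \<subseteq> basic b E"
proof -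
  show "D \<in> basic (r (Suc (len b)) D) E"
    using assms unfolding mem_basic by blast
  show "basic (r (Suc (len b)) D) E \<subseteq> basic b E"
    using basic_extend[OF assms] by simp
qed

lemma basic_unique_successor:
  assumes "r (Suc (len b)) ` basic b E = {b'}"
  shows "basic b' E = basic b E"
proof
  obtain D where D: "D \<in> basic b E" "r (Suc (len b)) D = b'"
    using assms by blast
  show "basic b' E \<subseteq> basic b E"
    using basic_successor(2)[OF D(1)] D(2) by simp
  show "basic b E \<subseteq> basic b' E"
  proof
    fix C assume C: "C \<in> basic b E"
    then have "r (Suc (len b)) C = b'" using assms by blast
    then show "C \<in> basic b' E"
      using basic_successor(1)[OF C] by simp
  qed
qed

text \<open>One stage of the fusion: \<open>F\<close> limits the successors that the future
  \<open>B\<close> may choose, and each of them has its own next stage. That stage continues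
  \<open>E\<close> rather than \<open>F\<close>, and it treats exactly the depths newly
  frozen.\<close>

lemma active_step:
  assumes G: "hereditary G" "dense_below A G" and A: "A \<in> R" "E \<preceq> A" and act: "active b E e"
  shows "\<exists>F\<in>H. F \<in> basic_at e E \<and> (\<forall>b'\<in>r (Suc (len b)) ` basic b F. \<exists>E' e'.
    E' \<in> basic_at e E \<and> e \<le> e' \<and> active b' E' e' \<and> (\<forall>d. e \<le> d \<longrightarrow> d < e' \<longrightarrow> good_at G E' d))"
proof -
  define ok where "ok b' \<longleftrightarrow> (\<exists>E' e'. E' \<in> basic_at e E \<and> e \<le> e' \<and> active b' E' e' \<and>
    (\<forall>d. e \<le> d \<longrightarrow> d < e' \<longrightarrow> good_at G E' d))" for b'
  let ?X = "\<lambda>E. r (Suc (len b)) ` basic b E"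
  have E: "E \<in> H" "E \<in> R"
    using act H_R unfolding active_def by blast+
  obtain F where F: "F \<in> H" "F \<in> basic_at e E" "?X F \<subseteq> Collect ok \<or> ?X F \<inter> Collect ok = {}"
    using active_pigeonhole[OF act] by blast
  have FR: "F \<in> R" using F H_R by blast
  have actF: "active b F e"
    using active_shrink[OF act F(2,1)] .
  \<comment> \<open>If no successor were admissible, a fusion sequence that need not have its limit in \<open>H\<close> would
    still have a limit compatible with \<open>b\<close>, and a successor of \<open>b\<close> below the limit is admissible.\<close>
  have False if none: "?X F \<inter> Collect ok = {}"
  proof -
    let ?S = "{b'. basic b' E \<noteq> {} \<and> depth E b' < e}"
    have finS: "finite ?S"
      by (rule finite_subset[OF _ finite_depth_le[OF E(2), of e]]) auto
    obtain F2 where F2: "F2 \<in> H" "F2 \<in> basic_at e F" "?X F2 \<subseteq> ?S \<or> ?X F2 \<inter> ?S = {}"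
      using active_pigeonhole[OF actF] by blast
    have F2R: "F2 \<in> R" using F2 H_R by blast
    have F2E: "F2 \<in> basic_at e E"
      using basic_at_trans[OF E(2) F(2) F2(2)] by simp
    have actF2: "active b F2 e"
      using active_shrink[OF actF F2(2,1)] .
    have XF2: "?X F2 \<subseteq> ?X F"
      using basic_at_basic_mono[OF FR F2(2)] by blast
    show False
    proof (cases "?X F2 \<subseteq> ?S")
      case True
      \<comment> \<open>Finitely many successors can be cut down to one. Then \<open>b\<close> and
        \<open>b'\<close> have the same basic set below \<open>F3\<close>, so \<open>b0\<close> also
        serves \<open>b'\<close>, with \<open>e\<close> unchanged and no depth to treat.\<close>
      then obtain F3 b' where F3: "F3 \<in> H" "F3 \<in> basic_at e F2" "?X F3 = {b'}"
        using active_singleton[OF actF2] finite_subset[OF True finS] by blast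
      have F3R: "F3 \<in> R" using F3 H_R by blast
      have F3E: "F3 \<in> basic_at e E"
        using basic_at_trans[OF E(2) F2E F3(2)] by simp
      have "b' \<in> ?X F2"
        using F3(3) basic_at_basic_mono[OF F2R F3(2)] by blast
      then have b': "b' \<in> ?S" "b' \<in> ?X F" using True XF2 by blast+
      obtain b0 where b0: "depth F3 b0 = e" "basic b0 F3 = basic b F3" "basic b F3 \<noteq> {}"
        using active_shrink[OF actF2 F3(2,1)] unfolding active_def by blast
      have "depth F3 b' \<le> e"
        using depth_basic_at(1)[OF E(2) F3E, of b'] b'(1) by simp
      then have "active b' F3 e"
        using b0 F3(1) basic_unique_successor[OF F3(3)] unfolding active_def by metis
      then have "ok b'"
        using F3E unfolding ok_def by (intro exI[of _ F3] exI[of _ e]) auto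
      then show False
        using none b'(2) by blast
    next
      case False
      then have disj: "?X F2 \<inter> ?S = {}"
        using F2(3) by blast
      have base: "\<exists>Q. Q \<in> H \<and> Q \<in> basic_at e F2 \<and> (\<forall>d. e \<le> d \<longrightarrow> d < e + 0 \<longrightarrow> good_at G Q d)"
        using F2(1) basic_at_refl[OF F2R] by auto
      have step: "\<exists>Q'. (Q' \<in> H \<and> Q' \<in> basic_at e F2 \<and> (\<forall>d. e \<le> d \<longrightarrow> d < e + Suc j \<longrightarrow> good_at G Q' d))
          \<and> Q' \<in> basic_at (e + j) Q"
        if Q: "Q \<in> H \<and> Q \<in> basic_at e F2 \<and> (\<forall>d. e \<le> d \<longrightarrow> d < e + j \<longrightarrow> good_at G Q d)" for Q j
      proof -
        have QR: "Q \<in> R" using Q H_R by blast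
        have "Q \<in> basic_at e E"
          using basic_at_trans[OF E(2) F2E] Q by blast
        then have "Q \<preceq> A"
          using le_transitive[OF basic_atD(2)[OF _ E(2)] A(2) QR E(2) A(1)] by blast
        then obtain Q' where Q': "Q' \<in> H" "Q' \<in> basic_at (e + j) Q" "good_at G Q' (e + j)"
          using ex_good_at[OF G _ _ A(1)] Q by blast
        have "Q' \<in> basic_at e F2"
          using basic_at_trans[OF F2R _ Q'(2)] Q by simp
        moreover have "good_at G Q' d" if "e \<le> d" "d < e + Suc j" for d
        proof (cases "d = e + j")
          case False
          then have "good_at G Q d" "d \<le> e + j"
            using Q that by auto
          then show ?thesis
            using good_at_shrink[OF G(1) _ _ Q'(1,2)] Q by blast
        qed (use Q' in simp)
        ultimately show ?thesis
          using Q' by blast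
      qed
      obtain Q where Q: "\<And>j. Q j \<in> H" "\<And>j. Q j \<in> basic_at e F2"
          "\<And>j d. \<lbrakk>e \<le> d; d < e + j\<rbrakk> \<Longrightarrow> good_at G (Q j) d" "\<And>j. Q (Suc j) \<in> basic_at (e + j) (Q j)"
        using dependent_nat_choice[where P = "\<lambda>j Q. Q \<in> H \<and> Q \<in> basic_at e F2 \<and>
            (\<forall>d. e \<le> d \<longrightarrow> d < e + j \<longrightarrow> good_at G Q d)" and Q = "\<lambda>j Q Q'. Q' \<in> basic_at (e + j) Q",
            OF base step] by blast
      have QR: "Q j \<in> R" for j using Q(1) H_R by blast
      have "\<exists>C\<in>R. \<forall>j. C \<in> basic_at (e + j) (Q j)"
        by (rule fusion_limit) (use QR Q(4) in \<open>auto intro: exI[of _ "_ - e"] trans_le_add2\<close>)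
      then obtain C where C: "C \<in> R" "\<And>j. C \<in> basic_at (e + j) (Q j)"
        by blast
      have CF2: "C \<in> basic_at e F2"
        using basic_at_trans[OF F2R Q(2)[of 0] C(2)[of 0]] by simp
      obtain D where D: "D \<in> basic b C"
        using active_compatible[OF actF2 CF2] by blast
      define b' where "b' = r (Suc (len b)) D"
      have b'C: "basic b' C \<noteq> {}"
        using basic_successor(1)[OF D] b'_def by blast
      have b'X: "b' \<in> ?X F2"
        using D basic_at_basic_mono[OF F2R CF2] b'_def by blast
      have CE: "C \<in> basic_at e E"
        using basic_at_trans[OF E(2) F2E CF2] by simp
      have "basic b' E \<noteq> {}"
        using b'C basic_at_basic_mono[OF E(2) CE] by blast
      then have "\<not> depth E b' < e"
        using disj b'X by blast
      then have ge: "e \<le> depth C b'"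
        using depth_basic_at(2)[OF E(2) CE b'C] by linarith
      \<comment> \<open>\<open>Q j\<close> has been treated at all depths from \<open>e\<close> up
        to but excluding \<open>e + j\<close>, and it agrees with \<open>C\<close> through
        \<open>e + j\<close>; so \<open>b'\<close> has depth \<open>e + j\<close> in
        \<open>Q j\<close> as well.\<close>
      define j where "j = depth C b' - e"
      have ej: "e + j = depth C b'"
        using ge by (simp add: j_def)
      have b'Q: "basic b' (Q j) \<noteq> {}"
        using b'C basic_at_basic_mono[OF QR C(2)] by blast
      have "depth (Q j) b' = e + j"
        using depth_basic_at(2)[OF QR C(2)[of j] b'C] ej by simp
      then have "active b' (Q j) (e + j)"
        using active_depth[OF Q(1) b'Q] by simp
      moreover have "Q j \<in> basic_at e E"
        using basic_at_trans[OF E(2) F2E Q(2)] by simp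
      ultimately have "ok b'"
        unfolding ok_def using Q(3) by (meson le_add1)
      then show False
        using none b'X XF2 by blast
    qed
  qed
  then have "?X F \<subseteq> Collect ok"
    using F(3) by blast
  then have "\<forall>b'\<in>?X F. ok b'"
    by blast
  then show ?thesis
    using F(1,2) unfolding ok_def by blast
qed

section \<open>The fusion lemma\<close>

lemma selectivity:
  assumes "A \<in> H" "\<And>a. a \<in> I \<Longrightarrow> F a \<in> H \<and> F a \<preceq> A \<and> basic a (F a) \<noteq> {}"
  shows "\<exists>B\<in>H. B \<preceq> A \<and> (\<forall>a\<in>I. basic a B \<noteq> {} \<longrightarrow> basic a B \<subseteq> basic a (F a))"
proof -
  have "I \<subseteq> AR"
    using assms(2) basic_nonempty_AR by blast
  moreover have "\<forall>a\<in>I. F a \<in> restrict_below H A \<and> basic a (F a) \<noteq> {}"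
    using assms(2) unfolding restrict_below_def by blast
  ultimately have "\<exists>B \<in> restrict_below H A. \<forall>a \<in> I \<inter> AR_below B. basic a B \<subseteq> basic a (F a)"
    using selective[unfolded selective_coideal_def, THEN conjunct2, rule_format, OF assms(1), of I F]
    by simp
  then show ?thesis
    unfolding restrict_below_def AR_below_iff[symmetric] by blast
qed

text \<open>Every possible initial segment \<open>b\<close> carries its own constraint
  \<open>F b\<close> on what may follow. Selectivity gives one \<open>B\<close> obeying the
  constraints met along itself, so only the states along \<open>B\<close> have to be fused.\<close>

lemma fusion_at_depth:
  assumes G: "hereditary G" "dense_below A G" and A: "A \<in> H"
  shows "\<exists>C\<in>H. C \<in> basic_at n A \<and> (\<exists>m. \<forall>d\<ge>m. good_at G C d)"
proof -
  have AR: "A \<in> R" using A H_R by blast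
  \<comment> \<open>The second disjunct covers the initial segments of \<open>B\<close> of depth below \<open>n\<close>, during which
    nothing is changed; therefore only the depths from some \<open>m\<close> on are treated.\<close>
  define Inv :: "'b \<Rightarrow> 'a \<times> nat \<Rightarrow> bool" where
    "Inv b s \<longleftrightarrow> fst s \<in> H \<and> fst s \<preceq> A \<and>
      (active b (fst s) (snd s) \<or> s = (A, n) \<and> basic b A \<noteq> {} \<and> depth A b < n)" for b s
  define nx :: "'b \<Rightarrow> 'a \<times> nat \<Rightarrow> 'b \<Rightarrow> 'a \<times> nat \<Rightarrow> bool" where
    "nx b s b' s' \<longleftrightarrow> Inv b' s' \<and> fst s' \<in> basic_at (snd s) (fst s) \<and> snd s \<le> snd s' \<and>
      (active b (fst s) (snd s) \<longrightarrow> active b' (fst s') (snd s') \<and>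
        (\<forall>d. snd s \<le> d \<longrightarrow> d < snd s' \<longrightarrow> good_at G (fst s') d))" for b s b' s'
  define adm where "adm b s F \<longleftrightarrow> F \<in> H \<and> F \<preceq> A \<and> basic b F \<noteq> {} \<and>
      (\<forall>b'\<in>r (Suc (len b)) ` basic b F. \<exists>s'. nx b s b' s')" for b s F
  have ex_adm: "\<exists>F. adm b s F" if inv: "Inv b s" for b s
  proof (cases "active b (fst s) (snd s)")
    case True
    obtain E e where s: "s = (E, e)" by fastforce
    have E: "E \<in> H" "E \<preceq> A" "active b E e" "E \<in> R"
      using inv True H_R s by (auto simp: Inv_def)
    obtain F where F: "F \<in> H" "F \<in> basic_at e E" and
      succ: "\<And>b'. b' \<in> r (Suc (len b)) ` basic b F \<Longrightarrow> \<exists>E' e'. E' \<in> basic_at e E \<and> e \<le> e' \<and>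
        active b' E' e' \<and> (\<forall>d. e \<le> d \<longrightarrow> d < e' \<longrightarrow> good_at G E' d)"
      using active_step[OF G AR E(2,3)] by blast
    have below: "D \<preceq> A" if "D \<in> basic_at e E" for D
      using le_transitive[OF basic_atD(2)[OF that E(4)] E(2) basic_atD(1)[OF that E(4)] E(4) AR] .
    have "\<exists>s'. nx b s b' s'" if b': "b' \<in> r (Suc (len b)) ` basic b F" for b'
    proof -
      obtain E' e' where E': "E' \<in> basic_at e E" "e \<le> e'" "active b' E' e'"
        "\<forall>d. e \<le> d \<longrightarrow> d < e' \<longrightarrow> good_at G E' d"
        using succ[OF b'] by blast
      have "E' \<in> H" using E'(3) unfolding active_def by blast
      then have "nx b s b' (E', e')"
        using E' below[OF E'(1)] unfolding nx_def Inv_def s by simp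
      then show ?thesis by blast
    qed
    moreover have "basic b F \<noteq> {}"
      using active_compatible[OF E(3) F(2)] .
    ultimately show ?thesis
      using F(1) below[OF F(2)] unfolding adm_def by blast
  next
    case False
    then have s: "s = (A, n)" "basic b A \<noteq> {}" "depth A b < n"
      using inv unfolding Inv_def by blast+
    have "\<exists>s'. nx b s b' s'" if b': "b' \<in> r (Suc (len b)) ` basic b A" for b'
    proof -
      have b'A: "basic b' A \<noteq> {}"
        using b' basic_successor(1) by blast
      \<comment> \<open>While \<open>b'\<close> has depth below \<open>n\<close> the state stays
        \<open>(A, n)\<close>; otherwise it becomes active with bound
        \<open>depth A b'\<close>.\<close>
      have "nx b s b' (A, max n (depth A b'))"
        using False active_depth[OF A b'A] A b'A le_reflexive[OF AR] basic_at_refl[OF AR]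
        unfolding nx_def Inv_def s(1) by (auto simp: max_def)
      then show ?thesis by blast
    qed
    then show ?thesis
      using A le_reflexive[OF AR] s(2) unfolding adm_def by blast
  qed
  define Fam where "Fam b s = (SOME F. adm b s F)" for b s
  have Fam: "adm b s (Fam b s)" if "Inv b s" for b s
    unfolding Fam_def using ex_adm[OF that] by (rule someI_ex)
  define nxt where "nxt b s b' = (SOME s'. nx b s b' s')" for b s b'
  have nxt: "nx b s b' (nxt b s b')" if "Inv b s" "b' \<in> r (Suc (len b)) ` basic b (Fam b s)" for b s b'
    unfolding nxt_def using Fam[OF that(1)] that(2) unfolding adm_def by (blast intro: someI_ex)
  \<comment> \<open>\<open>st D k\<close> depends on \<open>r k D\<close> only, which turns the states into a family indexed by \<open>AR\<close>.\<close>
  define st where "st D = rec_nat (A, n) (\<lambda>k s. nxt (r k D) s (r (Suc k) D))" for D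
  have st_0: "st D 0 = (A, n)" and st_Suc: "st D (Suc k) = nxt (r k D) (st D k) (r (Suc k) D)" for D k
    by (simp_all add: st_def)
  have st_cong: "st D k = st D' k" if "\<And>i. i \<le> k \<Longrightarrow> r i D = r i D'" for D D' k
    using that by (induction k) (simp_all add: st_0 st_Suc)
  define F where "F b = Fam b (st (SOME D. D \<in> R \<and> r (len b) D = b) (len b))" for b
  have F: "F (r k D) = Fam (r k D) (st D k)" if D: "D \<in> R" for D k
  proof -
    define D' where "D' = (SOME D'. D' \<in> R \<and> r k D' = r k D)"
    have D': "D' \<in> R \<and> r k D' = r k D"
      unfolding D'_def using D by (metis (mono_tags, lifting) someI_ex)
    then have "st D' k = st D k"
      using r_eq_initial[OF _ D] by (intro st_cong) blast
    then show ?thesis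
      unfolding F_def len_r[OF D] D'_def[symmetric] by simp
  qed
  \<comment> \<open>Selectivity needs its hypotheses at every index, so the family is cut down to
    the \<open>b\<close> that satisfy them; the invariant puts every initial segment of
    \<open>B\<close> into \<open>I\<close>.\<close>
  define I where "I = {b. F b \<in> H \<and> F b \<preceq> A \<and> basic b (F b) \<noteq> {}}"
  obtain B where B: "B \<in> H" "B \<preceq> A" "\<And>b. \<lbrakk>b \<in> I; basic b B \<noteq> {}\<rbrakk> \<Longrightarrow> basic b B \<subseteq> basic b (F b)"
    using selectivity[OF A, of I F] unfolding I_def by blast
  have BR: "B \<in> R" using B H_R by blast
  have succB: "r (Suc k) B \<in> r (Suc (len (r k B))) ` basic (r k B) (Fam (r k B) (st B k))"
    if "Inv (r k B) (st B k)" for k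
  proof -
    have "r k B \<in> I"
      using Fam[OF that] F[OF BR, of k] unfolding I_def adm_def by simp
    then have "B \<in> basic (r k B) (Fam (r k B) (st B k))"
      using B(3)[of "r k B"] mem_basic_self[OF BR, of k] F[OF BR, of k] by auto
    then show ?thesis
      using len_r[OF BR] by simp
  qed
  have InvB: "Inv (r k B) (st B k)" for k
  proof (induction k)
    case 0
    have eA: "basic emp A \<noteq> {}" using basic_emp[OF AR] by blast
    have "active emp A 0"
      using active_depth[OF A eA] depth_emp[OF AR] by simp
    then show ?case
      using eA depth_emp[OF AR] A le_reflexive[OF AR] A1[OF BR]
      by (cases "n = 0") (auto simp: Inv_def st_0)
  next
    case (Suc k)
    then show ?case
      using nxt[OF Suc succB[OF Suc]] unfolding st_Suc nx_def by blast
  qed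
  have nxB: "nx (r k B) (st B k) (r (Suc k) B) (st B (Suc k))" for k
    using nxt[OF InvB succB[OF InvB]] unfolding st_Suc .
  define E where "E k = fst (st B k)" for k
  define e where "e k = snd (st B k)" for k
  have ER: "E k \<in> R" for k
    using InvB[of k] H_R unfolding Inv_def E_def by blast
  have EH: "E k \<in> H" for k
    using InvB[of k] unfolding Inv_def E_def by blast
  have E_step: "E (Suc k) \<in> basic_at (e k) (E k)" "e k \<le> e (Suc k)" for k
    using nxB[of k] unfolding nx_def E_def e_def by blast+
  have e_mono: "e j \<le> e k" if "j \<le> k" for j k
    using E_step(2) that by (rule lift_Suc_mono_le)
  have later: "E k \<in> basic_at (e j) (E j)" if "j \<le> k" for j k
    using that
  proof (induction k rule: dec_induct)
    case base
    then show ?case by (rule basic_at_refl[OF ER])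
  next
    case (step k)
    then show ?case
      using basic_at_trans[OF ER _ E_step(1)[of k]] e_mono by blast
  qed
  have bB: "basic (r k B) (E k) \<noteq> {}" "depth (E k) (r k B) \<le> e k" for k
    using InvB[of k] unfolding Inv_def active_def E_def e_def by auto
  \<comment> \<open>If \<open>e\<close> were bounded with maximum \<open>e j\<close>, all
    \<open>r k B\<close> with \<open>k\<close> at least \<open>j\<close> would have depth at most
    \<open>e j\<close> in \<open>E j\<close>, but only finitely many approximations do.\<close>
  have unbounded: "\<exists>j. i \<le> e j" for i
  proof (rule ccontr)
    assume "\<nexists>j. i \<le> e j"
    then have "range e \<subseteq> {..<i}"
      by (auto simp: not_le)
    then have fin: "finite (range e)" using finite_subset by blast
    obtain j where j: "e j = Max (range e)"
      using Max_in[OF fin] by auto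
    have ej: "e k \<le> e j" for k
      using j fin by simp
    let ?Z = "{c. basic c (E j) \<noteq> {} \<and> depth (E j) c \<le> e j}"
    have "r k B \<in> ?Z" if "j \<le> k" for k
    proof -
      have "basic (r k B) (E j) \<noteq> {}"
        using bB(1)[of k] basic_at_basic_mono[OF ER later[OF that]] by blast
      moreover have "depth (E k) (r k B) = depth (E j) (r k B)"
        using depth_basic_at(2)[OF ER later[OF that] bB(1)] bB(2)[of k] ej[of k] by simp
      ultimately show ?thesis
        using bB(2)[of k] ej[of k] by simp
    qed
    then have "(\<lambda>k. r k B) ` {j..} \<subseteq> ?Z" by auto
    then have "finite ((\<lambda>k. r k B) ` {j..})"
      using finite_depth_le[OF ER] finite_subset by blast
    moreover have "inj_on (\<lambda>k. r k B) {j..}"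
      using r_eq_length[OF BR BR] by (auto intro: inj_onI)
    ultimately show False
      using finite_imageD infinite_Ici by blast
  qed
  obtain C where C: "C \<in> R" "\<And>j. C \<in> basic_at (e j) (E j)"
    using fusion_limit[of E e, OF ER E_step unbounded] by blast
  have "\<exists>m. r k B \<preceq>\<^sub>f r m C" for k
    using lefin_depth[OF ER bB(1), of k] basic_atD(3)[OF C(2) ER bB(2), of k] by metis
  then have "B \<preceq> C"
    using A4_le[OF BR C(1)] by blast
  then have CH: "C \<in> H"
    using H_upward[OF B(1) _ C(1)] by blast
  have CA: "C \<in> basic_at n A"
    using C(2)[of 0] unfolding E_def e_def st_0 by simp
  \<comment> \<open>Without an active stage the bound would stay \<open>n\<close> forever.\<close>
  obtain j0 where j0: "active (r j0 B) (E j0) (e j0)"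
  proof (rule ccontr)
    assume "\<not> thesis"
    then have "e k = n" for k
      using InvB[of k] that unfolding Inv_def E_def e_def by auto
    then show False
      using unbounded[of "Suc n"] by auto
  qed
  have act: "active (r k B) (E k) (e k)" if "j0 \<le> k" for k
    using that
  proof (induction k rule: dec_induct)
    case (step k)
    then show ?case
      using nxB[of k] unfolding nx_def E_def e_def by blast
  qed (rule j0)
  have "good_at G C d" if d: "e j0 \<le> d" for d
  proof -
    \<comment> \<open>The step into stage \<open>j\<close> is the one that passes depth
      \<open>d\<close> and makes it good; from then on \<open>d\<close> is frozen.\<close>
    define j where "j = (LEAST j. d < e j)"
    have dj: "d < e j"
      unfolding j_def using unbounded[of "Suc d"] Suc_le_eq by (metis (mono_tags, lifting) LeastI)
    have "j0 < j"
      using d dj e_mono[of j j0] by (meson leD leI order.trans)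
    then obtain i where i: "j = Suc i" "j0 \<le> i"
      by (cases j) auto
    have "\<not> d < e i"
      using not_less_Least[of i "\<lambda>j. d < e j"] i unfolding j_def by simp
    then have "good_at G (E j) d"
      using nxB[of i] act[OF i(2)] dj i(1) unfolding nx_def E_def e_def by simp
    then show ?thesis
      using good_at_shrink[OF G(1) _ EH CH C(2)] dj by simp
  qed
  then show ?thesis
    using CH CA by blast
qed

text \<open>All failures have depth below \<open>m\<close> in \<open>C\<close>, so there are
  finitely many. Passing from \<open>C\<close> to a member of \<open>basic a C\<close> creates no
  new failure because \<open>G\<close> is hereditary.\<close>

lemma fusion:
  assumes G: "hereditary G" "dense_below A G" and A: "A \<in> H" "basic a A \<noteq> {}"
  shows "\<exists>C\<in>H. C \<in> basic a A \<and> finite {c. basic c C \<noteq> {} \<and> \<not> G c C}"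
proof -
  have AR: "A \<in> R" using A H_R by blast
  obtain C m where C: "C \<in> H" "C \<in> basic_at (depth A a) A" "\<And>d. m \<le> d \<Longrightarrow> good_at G C d"
    using fusion_at_depth[OF G A(1)] by blast
  have CR: "C \<in> R" using C H_R by blast
  obtain D where D: "D \<in> H" "D \<in> basic a C"
    using coideal_basic[OF A C(2,1)] by blast
  have sub: "basic c D \<subseteq> basic c C" for c
    using D(2) CR mem_basic basic_mono by blast
  have "{c. basic c D \<noteq> {} \<and> \<not> G c D} \<subseteq> {c. basic c C \<noteq> {} \<and> depth C c \<le> m}"
  proof clarify
    fix c assume c: "basic c D \<noteq> {}" "\<not> G c D"
    have "\<not> G c C"
      using hereditaryD[OF G(1) C(1) D(1) _ sub c(1)] c(2) by blast
    then have "\<not> m \<le> depth C c"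
      using C(3)[of "depth C c"] c(1) sub unfolding good_at_def by blast
    then show "basic c C \<noteq> {} \<and> depth C c \<le> m"
      using c(1) sub by (auto simp del: not_le simp: not_le[symmetric])
  qed
  then have "finite {c. basic c D \<noteq> {} \<and> \<not> G c D}"
    using finite_depth_le[OF CR] finite_subset by blast
  then show ?thesis
    using D basic_at_basic_mono[OF AR C(2)] by blast
qed

lemma basic_memD:
  assumes "D \<in> basic c E"
  shows "D \<in> R" "D \<preceq> E" "D \<in> basic c D"
  using assms le_reflexive unfolding mem_basic by blast+

text \<open>At \<open>c\<close> only the requirements with index at most \<open>len c\<close> are
  imposed, so their conjunction stays dense. The finitely many exceptions have bounded length, hence
  requirement \<open>i\<close> holds at every sufficiently long \<open>c\<close>.\<close>

lemma fusion_countable: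
  fixes G :: "nat \<Rightarrow> 'b \<Rightarrow> 'a \<Rightarrow> bool"
  assumes G: "\<And>i. hereditary (G i)" "\<And>i. dense_below A (G i)" and A: "A \<in> H" "basic a A \<noteq> {}"
  shows "\<exists>C\<in>H. C \<in> basic a A \<and> (\<forall>i. \<exists>k. \<forall>c. basic c C \<noteq> {} \<longrightarrow> k \<le> len c \<longrightarrow> G i c C)"
proof -
  define G' where "G' c E \<longleftrightarrow> (\<forall>i\<le>len c. G i c E)" for c E
  have AR: "A \<in> R" using A H_R by blast
  have "hereditary G'"
    unfolding hereditary_def G'_def using hereditaryD[OF G(1)] by blast
  moreover have "dense_below A G'"
    unfolding dense_below_def
  proof (intro ballI allI impI)
    fix E c assume E: "E \<in> H" "E \<preceq> A" "basic c E \<noteq> {}"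
    have ER: "E \<in> R" using E H_R by blast
    have "\<exists>E'\<in>H. E' \<in> basic c E \<and> (\<forall>i<m. G i c E')" for m
    proof (induction m)
      case 0
      then show ?case using coideal_basic_self[OF E(1,3)] by blast
    next
      case (Suc m)
      then obtain E' where E': "E' \<in> H" "E' \<in> basic c E" "\<And>i. i < m \<Longrightarrow> G i c E'"
        by blast
      note E'' = basic_memD[OF E'(2)]
      have "E' \<preceq> A"
        using le_transitive[OF E''(2) E(2) E''(1) ER AR] .
      then obtain F where F: "F \<in> H" "F \<in> basic c E'" "G m c F"
        using G(2)[of m] E'(1) E''(3) unfolding dense_below_def by blast
      note F' = basic_memD[OF F(2)]
      have sub: "basic c F \<subseteq> basic c E'" "basic c E' \<subseteq> basic c E"
        using basic_mono[OF F'(2) E''(1) F'(1)] basic_mono[OF E''(2) ER E''(1)] by auto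
      have "G i c F" if "i < m" for i
        using hereditaryD[OF G(1) E'(1) F(1) E'(3)[OF that] sub(1)] F'(3) by blast
      then have "\<forall>i<Suc m. G i c F"
        using F(3) by (auto simp: less_Suc_eq)
      then show ?case
        using F sub by blast
    qed
    from this[of "Suc (len c)"] show "\<exists>E'\<in>H. E' \<in> basic c E \<and> G' c E'"
      unfolding G'_def less_Suc_eq_le .
  qed
  ultimately obtain C where C: "C \<in> H" "C \<in> basic a A" "finite {c. basic c C \<noteq> {} \<and> \<not> G' c C}"
    using fusion[OF _ _ A] by blast
  obtain L where L: "\<And>c. basic c C \<noteq> {} \<Longrightarrow> \<not> G' c C \<Longrightarrow> len c < L"
    using finite_imageI[OF C(3), of len] unfolding finite_nat_set_iff_bounded by blast
  have "G i c C" if "basic c C \<noteq> {}" "max L i \<le> len c" for i c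
    using L[OF that(1)] that(2) unfolding G'_def by fastforce
  then show ?thesis
    using C(1,2) by blast
qed

section \<open>Ramsey sets and finitely many undecided approximations\<close>

definition decided :: "'a set \<Rightarrow> 'b \<Rightarrow> 'a \<Rightarrow> bool" where
  "decided X c E \<longleftrightarrow> basic c E \<subseteq> X \<or> basic c E \<inter> X = {}"

text \<open>Formulated for arbitrary sets of the type, so that complements and sets given by
  conditions on approximations can be used directly.\<close>

definition ramsey :: "'a set \<Rightarrow> bool" where
  "ramsey X \<longleftrightarrow> (\<forall>E\<in>H. \<forall>c. basic c E \<noteq> {} \<longrightarrow> (\<exists>E'\<in>H. E' \<in> basic c E \<and> decided X c E'))"

lemma decided_mono: "\<lbrakk>decided X c E; basic c E' \<subseteq> basic c E\<rbrakk> \<Longrightarrow> decided X c E'"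
  unfolding decided_def by blast

lemma hereditary_decided: "hereditary (decided X)"
  unfolding hereditary_def using decided_mono by blast

lemma dense_below_decided: "ramsey X \<Longrightarrow> dense_below A (decided X)"
  unfolding dense_below_def ramsey_def by blast

lemma ramsey_wrt_iff: "ramsey_wrt H X \<longleftrightarrow> X \<subseteq> R \<and> ramsey X"
proof -
  have "B \<in> basic c E \<Longrightarrow> (basic c B \<noteq> {} \<and> (basic c B \<subseteq> X \<or> basic c B \<subseteq> R - X)) \<longleftrightarrow> decided X c B"
    for B c E
    using basic_memD[of B c E] basic_memD(1)[of _ c B] unfolding decided_def by blast
  then have "(\<exists>B \<in> basic c E \<inter> H. basic c B \<noteq> {} \<and> (basic c B \<subseteq> X \<or> basic c B \<subseteq> R - X)) \<longleftrightarrow>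
      (\<exists>B\<in>H. B \<in> basic c E \<and> decided X c B)" for c E
    by blast
  then show ?thesis
    unfolding ramsey_wrt_def ramsey_def using basic_nonempty_AR by meson
qed

text \<open>Pigeonhole either decides \<open>c\<close> through its successors or leaves only
  exceptional ones, which are cut down to a single longer \<open>c'\<close> with the same basic set.
  Lengths in \<open>Z\<close> are bounded, so this terminates.\<close>

lemma decided_finite_exceptions:
  assumes "finite Z" "E \<in> H" "basic c E \<noteq> {}"
    and "\<And>c. \<lbrakk>basic c E \<noteq> {}; c \<notin> Z\<rbrakk> \<Longrightarrow> decided X c E"
  shows "\<exists>E'\<in>H. E' \<in> basic c E \<and> decided X c E'"
proof -
  obtain L where L: "\<And>c. c \<in> Z \<Longrightarrow> len c < L"
    using finite_imageI[OF assms(1), of len] unfolding finite_nat_set_iff_bounded by blast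
  show ?thesis
    using assms(2-)
  proof (induction "L - len c" arbitrary: c E rule: less_induct)
    case less
    note dec = less.prems(3)
    have ER: "E \<in> R" using less.prems H_R by blast
    show ?case
    proof (cases "c \<in> Z")
      case False
      obtain D where D: "D \<in> H" "D \<in> basic c E"
        using coideal_basic_self[OF less.prems(1,2)] by blast
      have "basic c D \<subseteq> basic c E"
        using basic_memD[OF D(2)] basic_mono ER by blast
      then show ?thesis
        using D dec[OF less.prems(2) False] decided_mono by blast
    next
      case True
      let ?e = "depth E c"
      let ?X = "\<lambda>E. r (Suc (len c)) ` basic c E"
      define pos where "pos = {c'. c' \<notin> Z \<and> basic c' E \<subseteq> X}"
      define neg where "neg = {c'. c' \<notin> Z \<and> basic c' E \<inter> X = {}}"
      have act: "active c E ?e"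
        using active_depth less.prems by blast
      have finish: ?thesis if F: "F \<in> H" "F \<in> basic_at ?e E" "decided X c F" for F
      proof -
        have FR: "F \<in> R" using F H_R by blast
        obtain D where D: "D \<in> H" "D \<in> basic c F"
          using coideal_basic_self[OF F(1) active_compatible[OF act F(2)]] by blast
        have "basic c D \<subseteq> basic c F" "basic c F \<subseteq> basic c E"
          using basic_memD[OF D(2)] basic_mono FR basic_at_basic_mono[OF ER F(2)] by blast+
        then show ?thesis
          using D F(3) decided_mono by blast
      qed
      obtain F1 where F1: "F1 \<in> H" "F1 \<in> basic_at ?e E" "?X F1 \<subseteq> pos \<or> ?X F1 \<inter> pos = {}"
        using active_pigeonhole[OF act] by blast
      note act1 = active_shrink[OF act F1(2,1)]
      obtain F2 where F2: "F2 \<in> H" "F2 \<in> basic_at ?e F1" "?X F2 \<subseteq> neg \<or> ?X F2 \<inter> neg = {}"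
        using active_pigeonhole[OF act1] by blast
      note act2 = active_shrink[OF act1 F2(2,1)]
      have F1R: "F1 \<in> R" and F2R: "F2 \<in> R" using F1 F2 H_R by blast+
      have F2E: "F2 \<in> basic_at ?e E"
        using basic_at_trans[OF ER F1(2) F2(2)] by simp
      have sub: "basic c F1 \<subseteq> basic c E" "basic c F2 \<subseteq> basic c F1"
        using basic_at_basic_mono[OF ER F1(2)] basic_at_basic_mono[OF F1R F2(2)] by auto
      consider "?X F1 \<subseteq> pos" | "?X F2 \<subseteq> neg" | "?X F2 \<inter> pos = {}" "?X F2 \<inter> neg = {}"
        using F1(3) F2(3) sub by blast
      then show ?thesis
      proof cases
        case 1
        have "C \<in> X" if C: "C \<in> basic c F1" for C
          using 1 C basic_successor(1)[of C c E] sub unfolding pos_def by blast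
        then show ?thesis
          using finish[OF F1(1,2)] unfolding decided_def by blast
      next
        case 2
        have "C \<notin> X" if C: "C \<in> basic c F2" for C
          using 2 C basic_successor(1)[of C c E] sub unfolding neg_def by blast
        then show ?thesis
          using finish[OF F2(1) F2E] unfolding decided_def by blast
      next
        case 3
        \<comment> \<open>A successor outside \<open>Z\<close> would be decided already and so lie
          in \<open>pos\<close> or \<open>neg\<close>.\<close>
        have "?X F2 \<subseteq> Z"
        proof clarify
          fix C assume C: "C \<in> basic c F2"
          have "basic (r (Suc (len c)) C) E \<noteq> {}"
            using C sub basic_successor(1) by blast
          then show "r (Suc (len c)) C \<in> Z"
            using dec[of "r (Suc (len c)) C"] 3 C unfolding decided_def pos_def neg_def by blast
        qed
        then have "finite (?X F2)"
          using assms(1) finite_subset by blast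
        then obtain F3 c' where F3: "F3 \<in> H" "F3 \<in> basic_at ?e F2" "?X F3 = {c'}"
          using active_singleton[OF act2] by blast
        have F3R: "F3 \<in> R" using F3 H_R by blast
        have F3E: "F3 \<in> basic_at ?e E"
          using basic_at_trans[OF ER F2E F3(2)] by simp
        have eq: "basic c' F3 = basic c F3"
          using basic_unique_successor[OF F3(3)] .
        have ne: "basic c F3 \<noteq> {}"
          using active_compatible[OF act F3E] .
        obtain D where D: "D \<in> basic c F3" "r (Suc (len c)) D = c'"
          using F3(3) by blast
        then have "len c' = Suc (len c)"
          using len_r[OF basic_memD(1)[OF D(1)]] by blast
        then have less_L: "L - len c' < L - len c"
          using L[OF True] by linarith
        have "decided X c'' F3" if c'': "basic c'' F3 \<noteq> {}" "c'' \<notin> Z" for c''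
          using dec[of c''] c'' basic_at_basic_mono[OF ER F3E] decided_mono by blast
        then obtain E' where E': "E' \<in> H" "E' \<in> basic c F3" "decided X c' E'"
          using less.hyps[OF less_L F3(1)] ne eq by auto
        have "basic c E' \<subseteq> basic c' E'"
          using basic_restrict[OF basic_memD(2)[OF E'(2)] F3R basic_memD(1)[OF E'(2)]] eq by auto
        then have "decided X c E'"
          using E'(3) unfolding decided_def by blast
        then show ?thesis
          using E'(1,2) basic_at_basic_mono[OF ER F3E] by blast
      qed
    qed
  qed
qed

section \<open>Metrically open sets: accepting and rejecting\<close>

lemma finite_initial_segments:
  assumes "finite Z"
  shows "finite {c. \<exists>D\<in>R. \<exists>i k. i \<le> k \<and> r i D = c \<and> r k D \<in> Z}"
proof -
  \<comment> \<open>\<open>w z\<close> is one realization of \<open>z\<close>; by (A.3) all others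
    have the same approximations up to \<open>len z\<close>.\<close>
  define w where "w z = (SOME D. D \<in> R \<and> r (len z) D = z)" for z
  have "{c. \<exists>D\<in>R. \<exists>i k. i \<le> k \<and> r i D = c \<and> r k D \<in> Z} \<subseteq> (\<Union>z\<in>Z. (\<lambda>i. r i (w z)) ` {..len z})"
  proof clarify
    fix D i k assume D: "D \<in> R" "i \<le> k" "r k D \<in> Z"
    have len: "len (r k D) = k" using len_r[OF D(1)] .
    have w: "w (r k D) \<in> R \<and> r k (w (r k D)) = r k D"
      unfolding w_def len using D(1) by (metis (mono_tags, lifting) someI_ex)
    then have "r i (w (r k D)) = r i D"
      using r_eq_initial[of "w (r k D)" D k k i] D by blast
    then have "r i D \<in> (\<lambda>i. r i (w (r k D))) ` {..len (r k D)}"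
      using D(2) len by (metis atMost_iff image_eqI)
    then show "r i D \<in> (\<Union>z\<in>Z. (\<lambda>i. r i (w z)) ` {..len z})"
      using D(3) by blast
  qed
  then show ?thesis
    using assms finite_subset by blast
qed

text \<open>The first fusion makes almost every \<open>d\<close> accepted (its basic set lies in
  \<open>U\<close>) or rejected (no shrinking in \<open>H\<close> is accepted). The second ensures
  that, with finitely many exceptions, a \<open>d\<close> not accepted has no accepted successor. A
  point of \<open>U\<close> would have an accepted initial segment, so its basic sets avoid
  \<open>U\<close> at such \<open>d\<close>; the exceptions are absorbed at the end.\<close>

lemma relatively_open_decided:
  assumes E: "E \<in> H" "basic c E \<noteq> {}"
    and opn: "\<And>C. \<lbrakk>C \<in> U; C \<in> R; C \<preceq> E\<rbrakk> \<Longrightarrow> \<exists>k. basic (r k C) E \<subseteq> U"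
  shows "\<exists>E'\<in>H. E' \<in> basic c E \<and> decided U c E'"
proof -
  have ER: "E \<in> R" using E H_R by blast
  define rej where "rej d F \<longleftrightarrow>
    (\<forall>F'\<in>H. basic d F' \<noteq> {} \<longrightarrow> basic d F' \<subseteq> basic d F \<longrightarrow> \<not> basic d F' \<subseteq> U)" for d F
  define G where "G d F \<longleftrightarrow> basic d F \<subseteq> U \<or> rej d F" for d F
  have "hereditary G"
    unfolding hereditary_def G_def rej_def by (meson order.trans)
  moreover have "dense_below E G"
    unfolding dense_below_def
  proof (intro ballI allI impI)
    fix F d assume F: "F \<in> H" "F \<preceq> E" "basic d F \<noteq> {}"
    have FR: "F \<in> R" using F H_R by blast
    show "\<exists>F'\<in>H. F' \<in> basic d F \<and> G d F'"
    proof (cases "rej d F")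
      case True
      obtain D where D: "D \<in> H" "D \<in> basic d F"
        using coideal_basic_self[OF F(1,3)] by blast
      have "basic d D \<subseteq> basic d F"
        using basic_mono[OF basic_memD(2)[OF D(2)] FR basic_memD(1)[OF D(2)]] .
      then have "rej d D"
        using True unfolding rej_def by (meson order.trans)
      then show ?thesis
        using D unfolding G_def by blast
    next
      case False
      then obtain F' where F': "F' \<in> H" "basic d F' \<noteq> {}" "basic d F' \<subseteq> basic d F" "basic d F' \<subseteq> U"
        unfolding rej_def by blast
      obtain D where D: "D \<in> H" "D \<in> basic d F'"
        using coideal_basic_self[OF F'(1,2)] by blast
      have "basic d D \<subseteq> basic d F'"
        using basic_mono[OF basic_memD(2)[OF D(2)] H_R[OF F'(1)] basic_memD(1)[OF D(2)]] .
      then show ?thesis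
        using D F' unfolding G_def by blast
    qed
  qed
  ultimately obtain E1 where E1: "E1 \<in> H" "E1 \<in> basic c E" and fin1: "finite {d. basic d E1 \<noteq> {} \<and> \<not> G d E1}"
    using fusion[OF _ _ E] by blast
  note E1' = basic_memD[OF E1(2)]
  define Z1 where "Z1 = {d. basic d E1 \<noteq> {} \<and> \<not> G d E1}"
  \<comment> \<open>Acceptance refers to the fixed \<open>E1\<close>, and \<open>F\<close> only
    limits the successors. The set \<open>Z1\<close> excuses those \<open>d\<close> on which
    \<open>E1\<close> takes no position. Density holds since a rejected \<open>d\<close> cannot have
    all its successors accepted.\<close>
  define G' where "G' d F \<longleftrightarrow> d \<in> Z1 \<or> basic d E1 \<subseteq> U \<or>
    (\<forall>d'\<in>r (Suc (len d)) ` basic d F. \<not> basic d' E1 \<subseteq> U)" for d F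
  have "hereditary G'"
    unfolding hereditary_def G'_def by blast
  moreover have "dense_below E1 G'"
    unfolding dense_below_def
  proof (intro ballI allI impI)
    fix F d assume F: "F \<in> H" "F \<preceq> E1" "basic d F \<noteq> {}"
    have FR: "F \<in> R" using F H_R by blast
    have FE1: "basic d F \<subseteq> basic d E1"
      using basic_mono[OF F(2) E1'(1) FR] .
    obtain F1 where F1: "F1 \<in> H" "F1 \<in> basic_at (depth F d) F"
      "r (Suc (len d)) ` basic d F1 \<subseteq> {d'. basic d' E1 \<subseteq> U} \<or>
       r (Suc (len d)) ` basic d F1 \<inter> {d'. basic d' E1 \<subseteq> U} = {}"
      using coideal_pigeonhole[OF F(1,3)] by blast
    have F1F: "basic d F1 \<subseteq> basic d F"
      using basic_at_basic_mono[OF FR F1(2)] .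
    obtain D where D: "D \<in> H" "D \<in> basic d F1"
      using coideal_basic[OF F(1,3) F1(2,1)] by blast
    have DF1: "basic d D \<subseteq> basic d F1"
      using basic_mono[OF basic_memD(2)[OF D(2)] H_R[OF F1(1)] basic_memD(1)[OF D(2)]] .
    have "G' d F1"
    proof (rule ccontr)
      assume not: "\<not> G' d F1"
      then have acc: "r (Suc (len d)) ` basic d F1 \<subseteq> {d'. basic d' E1 \<subseteq> U}"
        using F1(3) unfolding G'_def by blast
      have "C \<in> U" if C: "C \<in> basic d F1" for C
        using acc C basic_successor(1)[of C d E1] F1F FE1 by blast
      moreover have "rej d E1"
        using not FE1 F(3) unfolding G'_def Z1_def G_def by blast
      ultimately show False
        using F1(1) D(2) F1F FE1 unfolding rej_def by blast
    qed
    then have "G' d D"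
      using DF1 unfolding G'_def by blast
    then show "\<exists>F'\<in>H. F' \<in> basic d F \<and> G' d F'"
      using D F1F by blast
  qed
  ultimately obtain E2 where E2: "E2 \<in> H" "E2 \<in> basic c E1" and fin2: "finite {d. basic d E2 \<noteq> {} \<and> \<not> G' d E2}"
    using fusion[OF _ _ E1(1)] E1'(3) by blast
  note E2' = basic_memD[OF E2(2)]
  define Z2 where "Z2 = Z1 \<union> {d. basic d E2 \<noteq> {} \<and> \<not> G' d E2}"
  \<comment> \<open>With the exceptions closed under initial segments, no extension of a
    \<open>d\<close> outside \<open>Z\<close> is exceptional, so the induction along
    \<open>C\<close> meets none.\<close>
  define Z where "Z = {d. \<exists>D\<in>R. \<exists>i k. i \<le> k \<and> r i D = d \<and> r k D \<in> Z2}"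
  have finZ: "finite Z"
    unfolding Z_def using finite_initial_segments fin1 fin2 unfolding Z2_def Z1_def by blast
  have E12: "basic d E2 \<subseteq> basic d E1" "basic d E1 \<subseteq> basic d E" for d
    using basic_mono[OF E2'(2) E1'(1) E2'(1)] basic_mono[OF E1'(2) ER E1'(1)] by auto
  have "decided U d E2" if d: "basic d E2 \<noteq> {}" "d \<notin> Z" for d
  proof (cases "basic d E1 \<subseteq> U")
    case True
    then show ?thesis using E12 unfolding decided_def by blast
  next
    case False
    have "C \<notin> U" if C: "C \<in> basic d E2" for C
    proof
      assume "C \<in> U"
      note C' = basic_memD[OF C]
      have CE: "C \<in> basic d E" using C E12 by blast
      have notZ: "r j C \<notin> Z2" if "len d \<le> j" for j
        using that d(2) C'(1) mem_basic_r[OF C] unfolding Z_def by blast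
      have notacc: "\<not> basic (r j C) E1 \<subseteq> U" if "len d \<le> j" for j
        using that
      proof (induction j rule: dec_induct)
        case base
        then show ?case using False mem_basic_r[OF C] by simp
      next
        case (step j)
        have CE2: "C \<in> basic (r j C) E2"
          using C'(1,2) unfolding mem_basic by blast
        then have "G' (r j C) E2" "r j C \<notin> Z1"
          using notZ[OF step(1)] unfolding Z2_def by blast+
        moreover have "r (Suc j) C \<in> r (Suc (len (r j C))) ` basic (r j C) E2"
          using CE2 len_r[OF C'(1), of j] by simp
        ultimately show ?case
          using step.IH unfolding G'_def by blast
      qed
      obtain k where k: "basic (r k C) E \<subseteq> U"
        using opn[OF \<open>C \<in> U\<close> C'(1) basic_memD(2)[OF CE]] by blast
      have "C \<in> basic (r k C) E"
        using C'(1) basic_memD(2)[OF CE] unfolding mem_basic by blast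
      \<comment> \<open>The index \<open>k\<close> from openness may be smaller than
        \<open>len d\<close>, where nothing is known about acceptance.\<close>
      then have "basic (r (max k (len d)) C) E \<subseteq> basic (r k C) E"
        using basic_extend[of C "r k C" E "max k (len d)"] len_r[OF C'(1)] by simp
      then show False
        using notacc[of "max k (len d)"] k E12(2)[of "r (max k (len d)) C"] by auto
    qed
    then show ?thesis
      unfolding decided_def by blast
  qed
  then obtain E' where "E' \<in> H" "E' \<in> basic c E2" "decided U c E'"
    using decided_finite_exceptions[OF finZ E2(1)] E2'(3) by blast
  then show ?thesis
    using E12 by blast
qed

section \<open>Countable set operations on Ramsey sets\<close>

lemma ramsey_Compl: "ramsey X \<Longrightarrow> ramsey (- X)"
proof -
  have "decided (- X) c E \<longleftrightarrow> decided X c E" for c E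
    unfolding decided_def by blast
  then show "ramsey X \<Longrightarrow> ramsey (- X)"
    unfolding ramsey_def by simp
qed

text \<open>Below \<open>E\<close> every sufficiently long approximation decides \<open>X i\<close>.
  A long initial segment of a point of \<open>X i\<close> can only decide it positively, so the
  union is relatively open below \<open>E\<close>.\<close>

lemma ramsey_UN:
  fixes X :: "nat \<Rightarrow> 'a set"
  assumes "\<And>i. ramsey (X i)"
  shows "ramsey (\<Union>i. X i)"
  unfolding ramsey_def
proof (intro ballI allI impI)
  fix A a assume A: "A \<in> H" "basic a A \<noteq> {}"
  obtain E where E: "E \<in> H" "E \<in> basic a A"
    and dec: "\<And>i. \<exists>k. \<forall>c. basic c E \<noteq> {} \<longrightarrow> k \<le> len c \<longrightarrow> decided (X i) c E"
    using fusion_countable[of "\<lambda>i. decided (X i)" A a]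
      hereditary_decided dense_below_decided[OF assms] A by blast
  note E' = basic_memD[OF E(2)]
  have "\<exists>k. basic (r k C) E \<subseteq> (\<Union>i. X i)" if C: "C \<in> (\<Union>i. X i)" "C \<in> R" "C \<preceq> E" for C
  proof -
    obtain i where i: "C \<in> X i" using C by blast
    obtain k where k: "\<And>c. \<lbrakk>basic c E \<noteq> {}; k \<le> len c\<rbrakk> \<Longrightarrow> decided (X i) c E"
      using dec by blast
    have CE: "C \<in> basic (r k C) E"
      using C unfolding mem_basic by blast
    then have "decided (X i) (r k C) E"
      using k[of "r k C"] len_r[OF C(2), of k] by auto
    then show ?thesis
      using CE i unfolding decided_def by blast
  qed
  then obtain E2 where "E2 \<in> H" "E2 \<in> basic a E" "decided (\<Union>i. X i) a E2"
    using relatively_open_decided[OF E(1)] E'(3) by blast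
  then show "\<exists>E'\<in>H. E' \<in> basic a A \<and> decided (\<Union>i. X i) a E'"
    using basic_mono[OF E'(2) H_R[OF A(1)] E'(1)] by blast
qed

lemma ramsey_Un:
  assumes "ramsey X" "ramsey Y"
  shows "ramsey (X \<union> Y)"
proof -
  have "X \<union> Y = (\<Union>i::nat. if i = 0 then X else Y)"
    by (auto split: if_splits)
  then show ?thesis
    using ramsey_UN[of "\<lambda>i. if i = 0 then X else Y"] assms by simp
qed

lemma ramsey_Diff: "\<lbrakk>ramsey X; ramsey Y\<rbrakk> \<Longrightarrow> ramsey (X - Y)"
  using ramsey_Compl[OF ramsey_Un[OF ramsey_Compl[of X], of Y]] by (simp add: Diff_eq)

lemma ramsey_Int: "\<lbrakk>ramsey X; ramsey Y\<rbrakk> \<Longrightarrow> ramsey (X \<inter> Y)"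
  using ramsey_Diff[OF _ ramsey_Compl, of X Y] by (simp add: Diff_eq)

text \<open>Membership in the complement is witnessed by a single approximation, so the complement
  is relatively open.\<close>

lemma ramsey_metric_closed: "ramsey {C. \<forall>k. r k C \<in> T}"
proof -
  have "ramsey {C. \<exists>k. r k C \<notin> T}"
    unfolding ramsey_def
  proof (intro ballI allI impI)
    fix E c assume E: "E \<in> H" "basic c E \<noteq> {}"
    show "\<exists>E'\<in>H. E' \<in> basic c E \<and> decided {C. \<exists>k. r k C \<notin> T} c E'"
    proof (rule relatively_open_decided[OF E])
      fix C assume C: "C \<in> {C. \<exists>k. r k C \<notin> T}" "C \<in> R"
      then obtain k where "r k C \<notin> T" by blast
      then have "basic (r k C) E \<subseteq> {C. \<exists>k. r k C \<notin> T}"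
        using mem_basic_r[of _ "r k C" E] len_r[OF C(2), of k] by (auto intro!: exI[of _ k])
      then show "\<exists>k. basic (r k C) E \<subseteq> {C. \<exists>k. r k C \<notin> T}" by blast
    qed
  qed
  then have "ramsey (- {C. \<exists>k. r k C \<notin> T})"
    by (rule ramsey_Compl)
  moreover have "- {C. \<exists>k. r k C \<notin> T} = {C. \<forall>k. r k C \<in> T}" by blast
  ultimately show ?thesis by simp
qed

section \<open>The Souslin operation\<close>

lemma ramsey_souslin:
  assumes X: "\<And>s. ramsey (X s)"
  shows "ramsey (souslin X)"
  unfolding ramsey_def
proof (intro ballI allI impI)
  fix A a assume A: "A \<in> H" "basic a A \<noteq> {}"
  have AR: "A \<in> R" using A H_R by blast
  \<comment> \<open>\<open>Y s\<close> is the contribution of the branches through \<open>s\<close>;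
    all \<open>n\<close> are required, including those below \<open>length s\<close>, which gives
    both \<open>Y_Nil\<close> and \<open>Y_X\<close>.\<close>
  define Y where "Y s = {C. \<exists>x. map x [0..<length s] = s \<and> (\<forall>n. C \<in> X (map x [0..<n]))}" for s
  have Y_Nil: "Y [] = souslin X"
    unfolding Y_def souslin_def by auto
  have Y_X: "Y s \<subseteq> X s" for s
    unfolding Y_def by (auto, metis)
  have Y_succ: "Y s \<subseteq> (\<Union>k. Y (s @ [k]))" for s
  proof
    fix C assume "C \<in> Y s"
    then obtain x where x: "map x [0..<length s] = s" "\<And>n. C \<in> X (map x [0..<n])"
      unfolding Y_def by blast
    then have "C \<in> Y (s @ [x (length s)])"
      unfolding Y_def by auto
    then show "C \<in> (\<Union>k. Y (s @ [k]))" by blast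
  qed

  \<comment> \<open>Either \<open>Y s\<close> is missed, or no shrinking in \<open>H\<close> can
    miss it; if the second fails at \<open>F\<close>, a shrinking satisfies the first.\<close>
  define G where "G s c F \<longleftrightarrow> basic c F \<inter> Y s = {} \<or>
    (\<forall>F'\<in>H. basic c F' \<noteq> {} \<longrightarrow> basic c F' \<subseteq> basic c F \<longrightarrow> basic c F' \<inter> Y s \<noteq> {})" for s c F
  have "hereditary (G s)" for s
    unfolding hereditary_def G_def by blast
  moreover have "dense_below A (G s)" for s
    unfolding dense_below_def
  proof (intro ballI allI impI)
    fix F c assume F: "F \<in> H" "basic c F \<noteq> {}"
    have "\<exists>F'\<in>H. basic c F' \<noteq> {} \<and> basic c F' \<subseteq> basic c F \<and> G s c F'"
      using F unfolding G_def by blast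
    then obtain F' where F': "F' \<in> H" "basic c F' \<noteq> {}" "basic c F' \<subseteq> basic c F" "G s c F'"
      by blast
    obtain D where D: "D \<in> H" "D \<in> basic c F'"
      using coideal_basic_self[OF F'(1,2)] by blast
    have "basic c D \<subseteq> basic c F'"
      using basic_mono[OF basic_memD(2)[OF D(2)] H_R[OF F'(1)] basic_memD(1)[OF D(2)]] .
    then have "G s c D"
      using F'(4) unfolding G_def by blast
    then show "\<exists>F'\<in>H. F' \<in> basic c F \<and> G s c F'"
      using D F' by blast
  qed
  ultimately obtain E where E: "E \<in> H" "E \<in> basic a A"
    and GE: "\<And>i. \<exists>k. \<forall>c. basic c E \<noteq> {} \<longrightarrow> k \<le> len c \<longrightarrow> G (from_nat i) c E"
    using fusion_countable[of "\<lambda>i. G (from_nat i)" A a] A by blast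
  note E' = basic_memD[OF E(2)]

  \<comment> \<open>The envelope of \<open>Y s\<close>: all approximations remain inseparable from
    \<open>Y s\<close> below \<open>E\<close>.\<close>
  define \<Psi> where "\<Psi> s = {C. \<forall>k. r k C \<in> {c. basic c E \<inter> Y s \<noteq> {}}}" for s
  \<comment> \<open>Outside \<open>W s\<close>, a point of the envelope of \<open>s\<close> lies in
    \<open>X s\<close> and in the envelope of some immediate extension of \<open>s\<close>.\<close>
  define W where "W s = \<Psi> s - X s \<inter> (\<Union>k. \<Psi> (s @ [k]))" for s
  have ramsey_\<Psi>: "ramsey (\<Psi> s)" for s
    unfolding \<Psi>_def by (rule ramsey_metric_closed)
  have ramsey_W: "ramsey (W s)" for s
    unfolding W_def by (intro ramsey_Diff ramsey_Int ramsey_UN ramsey_\<Psi> X)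
  have Y_\<Psi>: "C \<in> \<Psi> s" if "C \<in> Y s" "C \<in> R" "C \<preceq> E" for C s
    unfolding \<Psi>_def using that mem_basic by blast

  \<comment> \<open>Below \<open>E\<close> a point of \<open>Y s\<close> lies in \<open>X s\<close>
    and in some next envelope, so not in \<open>W s\<close>. A basic set inside \<open>W s\<close>
    thus misses \<open>Y s\<close>; by \<open>G\<close> at the longer \<open>c'\<close>, so does
    \<open>basic c' E\<close>, contradicting that \<open>D\<close> lies in the envelope.\<close>
  have W_thin: "\<not> basic c F \<subseteq> W s" if F: "F \<in> H" "F \<preceq> E" "basic c F \<noteq> {}" for F c s
  proof
    assume sub: "basic c F \<subseteq> W s"
    obtain k0 where k0: "\<And>c. \<lbrakk>basic c E \<noteq> {}; k0 \<le> len c\<rbrakk> \<Longrightarrow> G s c E"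
      using GE[of "to_nat s"] by auto
    obtain D where D: "D \<in> basic c F" using F by blast
    note D' = basic_memD[OF D]
    define c' where "c' = r (max k0 (len c)) D"
    have Dc': "D \<in> basic c' F"
      using D'(1,2) unfolding c'_def mem_basic by blast
    have c'sub: "basic c' F \<subseteq> basic c F"
      unfolding c'_def using basic_extend[OF D] by simp
    have FE: "basic d F \<subseteq> basic d E" for d
      using basic_mono[OF F(2) E'(1) H_R[OF F(1)]] .
    have "C \<notin> Y s" if C: "C \<in> basic c' F" for C
    proof
      assume CY: "C \<in> Y s"
      then obtain k where "C \<in> Y (s @ [k])" using Y_succ by blast
      then have "C \<in> \<Psi> (s @ [k])"
        using Y_\<Psi> basic_memD[of C c' E] C FE by blast
      then show False
        using CY Y_X sub c'sub C unfolding W_def by blast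
    qed
    then have "basic c' F \<inter> Y s = {}" by blast
    moreover have "G s c' E"
      using k0[of c'] Dc' FE[of c'] len_r[OF D'(1), of "max k0 (len c)"] unfolding c'_def[symmetric]
      by auto
    ultimately have "basic c' E \<inter> Y s = {}"
      using F(1) Dc' FE unfolding G_def by blast
    moreover have "D \<in> \<Psi> s"
      using D sub unfolding W_def by blast
    ultimately show False
      unfolding \<Psi>_def c'_def by blast
  qed

  \<comment> \<open>Since \<open>W s\<close> is Ramsey and contains no basic set given by a member
    of \<open>H\<close> below \<open>E\<close>, deciding it means avoiding it.\<close>
  define N where "N s c F \<longleftrightarrow> basic c F \<inter> W s = {}" for s c F
  have "hereditary (N s)" for s
    unfolding hereditary_def N_def by blast
  moreover have "dense_below E (N s)" for s
    unfolding dense_below_def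
  proof (intro ballI allI impI)
    fix F c assume F: "F \<in> H" "F \<preceq> E" "basic c F \<noteq> {}"
    obtain F' where F': "F' \<in> H" "F' \<in> basic c F" "decided (W s) c F'"
      using ramsey_W F unfolding ramsey_def by blast
    note F'' = basic_memD[OF F'(2)]
    have "F' \<preceq> E"
      using le_transitive[OF F''(2) F(2) F''(1) H_R[OF F(1)] E'(1)] .
    then have "N s c F'"
      using W_thin[OF F'(1)] F'(3) F''(3) unfolding decided_def N_def by blast
    then show "\<exists>F'\<in>H. F' \<in> basic c F \<and> N s c F'"
      using F' by blast
  qed
  ultimately obtain E2 where E2: "E2 \<in> H" "E2 \<in> basic a E"
    and NE2: "\<And>i. \<exists>k. \<forall>c. basic c E2 \<noteq> {} \<longrightarrow> k \<le> len c \<longrightarrow> N (from_nat i) c E2"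
    using fusion_countable[of "\<lambda>i. N (from_nat i)" E a] E(1) E'(3) by blast
  note E2' = basic_memD[OF E2(2)]
  have avoid: "C \<notin> W s" if C: "C \<in> R" "C \<preceq> E2" for C s
  proof -
    obtain k where k: "\<And>c. \<lbrakk>basic c E2 \<noteq> {}; k \<le> len c\<rbrakk> \<Longrightarrow> N s c E2"
      using NE2[of "to_nat s"] by auto
    have CE2: "C \<in> basic (r k C) E2"
      using C unfolding mem_basic by blast
    then have "N s (r k C) E2"
      using k[of "r k C"] len_r[OF C(1), of k] by auto
    then show ?thesis
      using CE2 unfolding N_def by blast
  qed
  have eq: "C \<in> souslin X \<longleftrightarrow> C \<in> \<Psi> []" if C: "C \<in> R" "C \<preceq> E2" for C
  proof
    assume "C \<in> souslin X"
    then show "C \<in> \<Psi> []"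
      using Y_\<Psi> Y_Nil C le_transitive[OF C(2) E2'(2) C(1) E2'(1) E'(1)] by blast
  next
    assume C0: "C \<in> \<Psi> []"
    have step: "C \<in> X s \<and> (\<exists>k. C \<in> \<Psi> (s @ [k]))" if "C \<in> \<Psi> s" for s
      using avoid[OF C, of s] that unfolding W_def by blast
    \<comment> \<open>Avoiding every \<open>W s\<close> lets the sequence be extended forever inside
      the envelopes; the last entries of \<open>f (Suc n)\<close> form the branch.\<close>
    obtain f :: "nat \<Rightarrow> nat list" where f: "f 0 = []" "\<And>n. C \<in> \<Psi> (f n)" "\<And>n. \<exists>k. f (Suc n) = f n @ [k]"
    proof -
      have "\<exists>f. \<forall>n. (C \<in> \<Psi> (f n) \<and> (n = 0 \<longrightarrow> f n = [])) \<and> (\<exists>k. f (Suc n) = f n @ [k])"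
        by (rule dependent_nat_choice) (use C0 step in blast)+
      then show ?thesis using that by blast
    qed
    define x where "x n = last (f (Suc n))" for n
    have "map x [0..<n] = f n" for n
    proof (induction n)
      case (Suc n)
      obtain k where "f (Suc n) = f n @ [k]" using f(3) by blast
      then show ?case using Suc by (simp add: x_def)
    qed (simp add: f(1))
    then have "C \<in> X (map x [0..<n])" for n
      using step[OF f(2)] by simp
    then show "C \<in> souslin X"
      unfolding souslin_def by blast
  qed
  \<comment> \<open>Below \<open>E2\<close> the Souslin set equals its envelope, so deciding the
    envelope is enough.\<close>
  obtain E3 where E3: "E3 \<in> H" "E3 \<in> basic a E2" "decided (\<Psi> []) a E3"
    using ramsey_\<Psi> E2(1) E2'(3) unfolding ramsey_def by blast
  note E3' = basic_memD[OF E3(2)]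
  have below: "C \<in> R \<and> C \<preceq> E2" if "C \<in> basic a E3" for C
    using le_transitive[OF basic_memD(2)[OF that] E3'(2) basic_memD(1)[OF that] E3'(1) E2'(1)]
      basic_memD(1)[OF that] by blast
  have "decided (souslin X) a E3"
    using E3(3) eq below unfolding decided_def by blast
  moreover have "E3 \<in> basic a A"
    using basic_mono[OF E'(2) AR E'(1)] basic_mono[OF E2'(2) E'(1) E2'(1)] E3(2) by blast
  ultimately show "\<exists>E'\<in>H. E' \<in> basic a A \<and> decided (souslin X) a E'"
    using E3(1) by blast
qed

end

theorem mainTheorem8:
  fixes R :: "'a set"
    and le :: "'a \<Rightarrow> 'a \<Rightarrow> bool"
    and r :: "nat \<Rightarrow> 'a \<Rightarrow> 'b"
    and lefin :: "'b \<Rightarrow> 'b \<Rightarrow> bool"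
    and emp :: 'b
    and H :: "'a set"
    and X :: "nat list \<Rightarrow> 'a set"
  assumes "topological_ramsey_space R le r lefin emp"
    and "ramsey_structure.selective_coideal R le r lefin H"
    and "\<And>s. ramsey_structure.ramsey_wrt R le r H (X s)"
  shows "ramsey_structure.ramsey_wrt R le r H (souslin X)"
proof -
  interpret topological_ramsey_space R le r lefin emp
    by (rule assms(1))
  interpret selective_ramsey_space R le r lefin emp H
    by unfold_locales (rule assms(2))
  have X: "X s \<subseteq> R" "ramsey (X s)" for s
    using assms(3)[of s] unfolding ramsey_wrt_iff by blast+
  have "souslin X \<subseteq> R"
    using X(1) unfolding souslin_def by blast
  then show ?thesis
    unfolding ramsey_wrt_iff using ramsey_souslin[of X] X(2) by blast
qed

end
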